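(* Let $\varphi:D\to D$ be an analytic self-map of $D$, let $g\in H(D)$, and let $0<\beta<\infty$. Let $V_gC_\varphi$ be the operator $(V_gC_\varphi f)(z)=\int_0^z f'(\varphi(\xi))g(\xi)\,d\xi$. (i) If $0<\alpha<1$, then $V_gC_\varphi:\mathcal{Z}^\alpha\to\mathcal{Z}^\beta$ is a bounded operator if and only if $g'\in H^\infty_{v_\beta}$ and $$\sup_{n\ge 0}(n+1)^\alpha\|g\varphi'\varphi^n\|_{v_\beta}\asymp\sup_{z\in D}\frac{(1-|z|^2)^\beta}{(1-|\varphi(z)|^2)^\alpha}|g(z)\varphi'(z)|<\infty.$$ (ii) If $\alpha=1$, then $V_gC_\varphi:\mathcal{Z}^\alpha\to\mathcal{Z}^\beta$ is a bounded operator if and only if $$\sup_{n\ge 0}(n+1)\|g\varphi'\varphi^n\|_{v_\beta}\asymp\sup_{z\in D}\frac{(1-|z|^2)^\beta}{1-|\varphi(z)|^2}|g(z)\varphi'(z)|<\infty$$ and $$\sup_{n\ge 0}\log(n+2)\,\|g'\varphi^n\|_{v_\beta}\asymp\sup_{z\in D}(1-|z|^2)^\beta\log\Big(\frac{2}{1-|\varphi(z)|^2}\Big)|g'(z)|<\infty.$$ (iii) If $\alpha>1$, then $V_gC_\varphi:\mathcal{Z}^\alpha\to\mathcal{Z}^\beta$ is a bounded operator if and only if $$\sup_{n\ge 0}(n+1)^\alpha\|g\varphi'\varphi^n\|_{v_\beta}\asymp\sup_{z\in D}\frac{(1-|z|^2)^\beta}{(1-|\varphi(z)|^2)^\alpha}|g(z)\varphi'(z)|<\infty$$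 and $$\sup_{n\ge 0}(n+1)^{\alpha-1}\|g'\varphi^n\|_{v_\beta}\asymp\sup_{z\in D}\frac{(1-|z|^2)^\beta}{(1-|\varphi(z)|^2)^{\alpha-1}}|g'(z)|<\infty.$$
   Context: $D=\{z\in\mathbb{C}:|z|<1\}$ and $H(D)$ is the set of analytic functions on $D$. For $0<\alpha<\infty$, the Zygmund type space $\mathcal{Z}^\alpha$ is the Banach space of $f\in H(D)$ with $\sup_{z\in D}(1-|z|^2)^\alpha|f''(z)|<\infty$, normed by $\|f\|_{\mathcal{Z}^\alpha}=|f(0)|+|f'(0)|+\sup_{z\in D}(1-|z|^2)^\alpha|f''(z)|$. For $0<\beta<\infty$, $v_\beta(z)=(1-|z|^2)^\beta$, $\|h\|_{v_\beta}=\sup_{z\in D}v_\beta(z)|h(z)|$ (possibly $+\infty$) for $h\in H(D)$, and $H^\infty_{v_\beta}=\{h\in H(D):\|h\|_{v_\beta}<\infty\}$. $\varphi^n$ denotes the $n$-th power (pointwise product) of $\varphi$, with $\varphi^0=1$. $A\asymp B$ means that there are positive constants $C_1,C_2$ with $C_1A\le B\le C_2A$ (constants not depending on $g$ or $\varphi$); a condition "$A\asymp B<\infty$" means that the two quantities are comparable and finite. *)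

theory Defs
  imports "HOL-Complex_Analysis.Complex_Analysis"
begin

text \<open>
  Analytic functions on the unit disk are represented by total functions that are holomorphic on
  \<open>unit_disk\<close>; every notion below depends only on their values there. Norms and suprema take values
  in \<^typ>\<open>ennreal\<close>, so that a supremum may be infinite. All real numbers embedded by \<^const>\<open>ennreal\<close>
  are nonnegative.
\<close>

abbreviation unit_disk :: "complex set" where
  "unit_disk \<equiv> ball 0 1"

definition analytic_self_map :: "(complex \<Rightarrow> complex) \<Rightarrow> bool" where
  "analytic_self_map \<phi> \<longleftrightarrow> \<phi> holomorphic_on unit_disk \<and> \<phi> ` unit_disk \<subseteq> unit_disk"

definition std_weight :: "real \<Rightarrow> complex \<Rightarrow> real" where
  "std_weight \<beta> z = (1 - (cmod z)\<^sup>2) powr \<beta>"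

definition weighted_norm :: "real \<Rightarrow> (complex \<Rightarrow> complex) \<Rightarrow> ennreal" where
  "weighted_norm \<beta> h = (SUP z\<in>unit_disk. ennreal (std_weight \<beta> z * cmod (h z)))"

definition weighted_Hinf :: "real \<Rightarrow> (complex \<Rightarrow> complex) set" where
  "weighted_Hinf \<beta> = {h. h holomorphic_on unit_disk \<and> weighted_norm \<beta> h < \<infinity>}"

definition zygmund_space :: "real \<Rightarrow> (complex \<Rightarrow> complex) set" where
  "zygmund_space \<alpha> =
     {f. f holomorphic_on unit_disk \<and>
         (SUP z\<in>unit_disk. ennreal ((1 - (cmod z)\<^sup>2) powr \<alpha> * cmod (deriv (deriv f) z))) < \<infinity>}"

definition zygmund_norm :: "real \<Rightarrow> (complex \<Rightarrow> complex) \<Rightarrow> ennreal" where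
  "zygmund_norm \<alpha> f =
     ennreal (cmod (f 0)) + ennreal (cmod (deriv f 0)) +
     (SUP z\<in>unit_disk. ennreal ((1 - (cmod z)\<^sup>2) powr \<alpha> * cmod (deriv (deriv f) z)))"

text \<open>The integral from \<open>0\<close> to \<open>z\<close> is taken along the segment, which stays inside the disk.\<close>

definition VC_operator ::
  "(complex \<Rightarrow> complex) \<Rightarrow> (complex \<Rightarrow> complex) \<Rightarrow> (complex \<Rightarrow> complex) \<Rightarrow> complex \<Rightarrow> complex" where
  "VC_operator g \<phi> f z = contour_integral (linepath 0 z) (\<lambda>\<xi>. deriv f (\<phi> \<xi>) * g \<xi>)"

text \<open>Images under the operator are compared only on the disk, where they are meaningful.\<close>

definition bounded_zygmund_operator ::
  "real \<Rightarrow> real \<Rightarrow> ((complex \<Rightarrow> complex) \<Rightarrow> complex \<Rightarrow> complex) \<Rightarrow> bool" where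
  "bounded_zygmund_operator \<alpha> \<beta> T \<longleftrightarrow>
     (\<forall>f\<in>zygmund_space \<alpha>. T f \<in> zygmund_space \<beta>) \<and>
     (\<forall>f\<in>zygmund_space \<alpha>. \<forall>h\<in>zygmund_space \<alpha>. \<forall>a b. \<forall>z\<in>unit_disk.
        T (\<lambda>w. a * f w + b * h w) z = a * T f z + b * T h z) \<and>
     (\<exists>K\<ge>0. \<forall>f\<in>zygmund_space \<alpha>. zygmund_norm \<beta> (T f) \<le> ennreal K * zygmund_norm \<alpha> f)"

text \<open>
  The condition written \<open>A \<asymp> B < \<infinity>\<close>, with explicit constants: whoever uses it must say what the
  constants may depend on by the place where they are quantified.
\<close>

definition comparable_finite :: "real \<Rightarrow> real \<Rightarrow> ennreal \<Rightarrow> ennreal \<Rightarrow> bool" where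
  "comparable_finite C1 C2 A B \<longleftrightarrow>
     ennreal C1 * A \<le> B \<and> B \<le> ennreal C2 * A \<and> A < \<infinity> \<and> B < \<infinity>"

end

theory Submission
  imports Defs
begin

text \<open>
  The second derivative of the image of \<open>f\<close> under the operator is
  \<open>f''(\<phi> z) \<phi>'(z) g(z) + f'(\<phi> z) g'(z)\<close> (lemma \<open>VC_operator_on_disk\<close>), and the image vanishes at
  \<open>0\<close>. So boundedness asks how large \<open>f''\<close> and \<open>f'\<close> can be at a point \<open>w = \<phi> z\<close> for \<open>f\<close> in the unit
  ball of \<open>zygmund_space \<alpha>\<close>. For \<open>f''\<close> the answer is \<open>(1 - \<bar>w\<bar>\<^sup>2) powr - \<alpha>\<close> by definition; for \<open>f'\<close>,
  integration along a radius gives a constant, a logarithm or \<open>(1 - \<bar>w\<bar>\<^sup>2) powr (1 - \<alpha>)\<close> according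
  to whether \<open>\<alpha>\<close> is below, at or above \<open>1\<close> (\<open>norm_le_derivative_growth\<close>).

  If the two weighted suprema, of \<open>g \<phi>'\<close> and of \<open>g'\<close>, with these sizes as additional weights are
  finite, the operator is bounded (\<open>bounded_VC_operatorI\<close>). Conversely, the two terms can be
  separated by test functions (\<open>bounded_VC_operatorD\<close>). For every \<open>a\<close> in the disk there is an \<open>f\<close>
  of bounded norm with \<open>f' a = 0\<close> and \<open>f'' a\<close> of extremal size (\<open>vanishing_test_function\<close>), which
  bounds the \<open>g \<phi>'\<close> term; once this is known, an \<open>f\<close> with \<open>f' a\<close> of extremal size
  (\<open>growth_test_function\<close>) bounds the \<open>g'\<close> term.

  The comparability with the sequence of norms of \<open>g \<phi>' \<phi>\<^sup>n\<close> and \<open>g' \<phi>\<^sup>n\<close> holds for every \<open>\<phi>\<close> and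
  \<open>g\<close>, as a comparability of possibly infinite quantities. After the suprema over \<open>n\<close> and \<open>z\<close> are
  exchanged it is the elementary fact that, for \<open>0 \<le> r < 1\<close>, the supremum over \<open>n\<close> of
  \<open>(n + 1) powr \<gamma> * r ^ n\<close> is comparable to \<open>(1 - r\<^sup>2) powr - \<gamma>\<close>, and that of \<open>ln (n + 2) * r ^ n\<close> to
  \<open>ln (2 / (1 - r\<^sup>2))\<close> (\<open>comparable_finite_power_weights_iff\<close>). Hence each condition in the theorem
  only says that the corresponding weighted supremum is finite. In the case \<open>\<alpha> < 1\<close>, the second
  supremum is the norm of \<open>g'\<close>.
\<close>

section \<open>Weighted suprema and powers of a self-map\<close>

lemma SUP_ennreal_less_top_iff:
  fixes x :: "'a \<Rightarrow> real"
  shows "(SUP z\<in>A. ennreal (x z)) < \<infinity> \<longleftrightarrow> (\<exists>M. \<forall>z\<in>A. x z \<le> M)"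
proof
  assume fin: "(SUP z\<in>A. ennreal (x z)) < \<infinity>"
  have "x z \<le> enn2real (SUP z\<in>A. ennreal (x z))" if "z \<in> A" for z
  proof -
    have "ennreal (x z) \<le> ennreal (enn2real (SUP z\<in>A. ennreal (x z)))"
      using fin that by (subst ennreal_enn2real) (auto intro: SUP_upper)
    then show ?thesis
      using ennreal_le_iff[OF enn2real_nonneg] by blast
  qed
  then show "\<exists>M. \<forall>z\<in>A. x z \<le> M" by blast
next
  assume "\<exists>M. \<forall>z\<in>A. x z \<le> M"
  then obtain M where "\<forall>z\<in>A. x z \<le> M" ..
  then have "(SUP z\<in>A. ennreal (x z)) \<le> ennreal M"
    by (intro SUP_least ennreal_leI) auto
  also have "\<dots> < \<infinity>" by simp
  finally show "(SUP z\<in>A. ennreal (x z)) < \<infinity>" .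
qed

text \<open>
  The two suprema over \<open>n\<close> and \<open>z\<close> may be exchanged, so comparability of \<open>k n * r ^ n\<close> with
  \<open>\<Lambda> r\<close>, uniformly for \<open>r\<close> in \<open>[0, 1)\<close>, passes to the two quantities with \<open>r = \<bar>\<phi> z\<bar>\<close>. The two
  inequalities in \<open>comparable_finite\<close> hold even when both sides are infinite; all that is left of the
  condition is finiteness.
\<close>

lemma comparable_finite_power_weights_iff:
  fixes k :: "nat \<Rightarrow> real" and \<Lambda> :: "real \<Rightarrow> real"
  assumes \<phi>: "\<phi> ` unit_disk \<subseteq> unit_disk"
    and k: "\<And>n. 0 \<le> k n" and pos: "0 < c" "0 < C"
    and upper: "\<And>n r. 0 \<le> r \<Longrightarrow> r < 1 \<Longrightarrow> k n * r ^ n \<le> c * \<Lambda> r"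
    and lower: "\<And>r. 0 \<le> r \<Longrightarrow> r < 1 \<Longrightarrow> \<exists>n. \<Lambda> r \<le> C * (k n * r ^ n)"
  shows "comparable_finite (1 / c) C
           (SUP n. ennreal (k n) * weighted_norm \<beta> (\<lambda>z. u z * \<phi> z ^ n))
           (SUP z\<in>unit_disk. ennreal ((1 - (cmod z)\<^sup>2) powr \<beta> * \<Lambda> (cmod (\<phi> z)) * cmod (u z)))
         \<longleftrightarrow> (\<exists>M. \<forall>z\<in>unit_disk. (1 - (cmod z)\<^sup>2) powr \<beta> * \<Lambda> (cmod (\<phi> z)) * cmod (u z) \<le> M)"
    (is "comparable_finite _ _ ?A ?B \<longleftrightarrow> ?bdd")
proof -
  define w where "w z = (1 - (cmod z)\<^sup>2) powr \<beta> * cmod (u z)" for z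
  have w: "0 \<le> w z" for z by (simp add: w_def)
  have B: "?B = (SUP z\<in>unit_disk. ennreal (w z * \<Lambda> (cmod (\<phi> z))))"
    by (simp add: w_def mult_ac)
  have A: "?A = (SUP n. SUP z\<in>unit_disk. ennreal (w z * (k n * cmod (\<phi> z) ^ n)))"
    unfolding weighted_norm_def SUP_mult_left_ennreal
    by (intro SUP_cong refl)
       (simp add: w_def std_weight_def norm_mult norm_power mult_ac flip: ennreal_mult[OF k])
  have \<phi>1: "cmod (\<phi> z) < 1" if "z \<in> unit_disk" for z using \<phi> that by force
  have "?A \<le> ennreal c * ?B"
    unfolding A B SUP_mult_left_ennreal
  proof (intro SUP_least)
    fix n z assume z: "z \<in> unit_disk"
    have "w z * (k n * cmod (\<phi> z) ^ n) \<le> c * (w z * \<Lambda> (cmod (\<phi> z)))"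
      using mult_left_mono[OF upper[OF norm_ge_zero \<phi>1[OF z]] w, of z n] by (simp add: mult_ac)
    then have "ennreal (w z * (k n * cmod (\<phi> z) ^ n)) \<le> ennreal c * ennreal (w z * \<Lambda> (cmod (\<phi> z)))"
      using pos by (simp add: ennreal_leI flip: ennreal_mult')
    also have "\<dots> \<le> (SUP z\<in>unit_disk. ennreal c * ennreal (w z * \<Lambda> (cmod (\<phi> z))))"
      using z by (rule SUP_upper)
    finally show "ennreal (w z * (k n * cmod (\<phi> z) ^ n)) \<le> \<dots>" .
  qed
  then have "ennreal (1 / c) * ?A \<le> ennreal (1 / c) * (ennreal c * ?B)"
    by (rule mult_left_mono) simp
  also have "\<dots> = ?B"
    using pos by (simp add: mult.assoc[symmetric] flip: ennreal_mult)
  finally have 1: "ennreal (1 / c) * ?A \<le> ?B" .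
  have 2: "?B \<le> ennreal C * ?A"
    unfolding A B
  proof (intro SUP_least)
    fix z assume z: "z \<in> unit_disk"
    obtain n where n: "\<Lambda> (cmod (\<phi> z)) \<le> C * (k n * cmod (\<phi> z) ^ n)"
      using lower[OF norm_ge_zero \<phi>1[OF z]] by blast
    have "w z * \<Lambda> (cmod (\<phi> z)) \<le> C * (w z * (k n * cmod (\<phi> z) ^ n))"
      using mult_left_mono[OF n w, of z] by (simp add: mult_ac)
    then have "ennreal (w z * \<Lambda> (cmod (\<phi> z))) \<le> ennreal C * ennreal (w z * (k n * cmod (\<phi> z) ^ n))"
      using pos by (simp add: ennreal_leI flip: ennreal_mult')
    also have "\<dots> \<le> ennreal C * (SUP n. SUP z\<in>unit_disk. ennreal (w z * (k n * cmod (\<phi> z) ^ n)))"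
      using z by (intro mult_left_mono SUP_upper2[of n] SUP_upper2[of z]) auto
    finally show "ennreal (w z * \<Lambda> (cmod (\<phi> z))) \<le> \<dots>" .
  qed
  have "?A < \<infinity>" if "?B < \<infinity>"
  proof -
    have "?A \<le> ennreal c * ?B" by fact
    also have "\<dots> < \<infinity>" using that by (simp add: ennreal_mult_less_top)
    finally show ?thesis .
  qed
  with 1 2 have "comparable_finite (1 / c) C ?A ?B \<longleftrightarrow> ?B < \<infinity>"
    unfolding comparable_finite_def by blast
  then show ?thesis
    unfolding SUP_ennreal_less_top_iff .
qed

text \<open>
  Since \<open>r \<le> exp (r - 1)\<close>, the power \<open>r ^ n\<close> is at most \<open>e * exp (- y)\<close> with
  \<open>y = (n + 1) (1 - r)\<close>, and \<open>y powr \<gamma> \<le> \<gamma> powr \<gamma> * exp y\<close>. The factor \<open>2 powr \<gamma>\<close> pays for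
  replacing \<open>1 - r\<close> by \<open>1 - r\<^sup>2\<close>.
\<close>

lemma Suc_powr_mult_power_le:
  fixes \<gamma> r :: real
  assumes "0 < \<gamma>" "0 \<le> r" "r < 1"
  shows "(real n + 1) powr \<gamma> * r ^ n \<le> exp 1 * (2 * \<gamma>) powr \<gamma> * (1 / (1 - r\<^sup>2) powr \<gamma>)"
proof -
  define y where "y = (real n + 1) * (1 - r)"
  have y: "0 < y" using assms by (simp add: y_def)
  have x: "0 < 1 - r\<^sup>2" using assms by (simp add: power_less_one_iff)
  have "r ^ n \<le> exp (- (1 - r)) ^ n"
    using assms exp_ge_add_one_self[of "- (1 - r)"] by (intro power_mono) auto
  also have "\<dots> = exp (1 - r - y)"
    by (simp add: y_def algebra_simps flip: exp_of_nat_mult)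
  also have "\<dots> \<le> exp (1 - y)"
    using assms by simp
  finally have r: "r ^ n \<le> exp 1 * exp (- y)"
    by (simp add: exp_diff exp_minus field_simps)
  have "y / \<gamma> \<le> exp (y / \<gamma>)"
    using exp_ge_add_one_self[of "y / \<gamma>"] by linarith
  then have "(y / \<gamma>) powr \<gamma> \<le> exp (y / \<gamma>) powr \<gamma>"
    using assms y by (intro powr_mono2) auto
  also have "\<dots> = exp y"
    using assms by (simp add: powr_def)
  finally have yg: "y powr \<gamma> \<le> \<gamma> powr \<gamma> * exp y"
    using assms y by (simp add: powr_divide field_simps)
  have "(1 - r\<^sup>2) powr \<gamma> * (real n + 1) powr \<gamma> = ((real n + 1) * (1 - r) * (1 + r)) powr \<gamma>"
    using assms x by (simp add: power2_eq_square algebra_simps flip: powr_mult)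
  also have "\<dots> \<le> (2 * y) powr \<gamma>"
  proof (intro powr_mono2)
    show "(real n + 1) * (1 - r) * (1 + r) \<le> 2 * y"
      using assms y mult_left_mono[of "1 + r" 2 y] by (simp add: y_def mult_ac)
  qed (use assms in auto)
  also have "\<dots> = 2 powr \<gamma> * y powr \<gamma>"
    using y by (simp add: powr_mult)
  also have "\<dots> \<le> 2 powr \<gamma> * (\<gamma> powr \<gamma> * exp y)"
    using yg by simp
  also have "\<dots> = (2 * \<gamma>) powr \<gamma> * exp y"
    using assms by (simp add: powr_mult)
  finally have yn: "(1 - r\<^sup>2) powr \<gamma> * (real n + 1) powr \<gamma> \<le> (2 * \<gamma>) powr \<gamma> * exp y" .
  have "(1 - r\<^sup>2) powr \<gamma> * (real n + 1) powr \<gamma> * r ^ n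
      \<le> ((2 * \<gamma>) powr \<gamma> * exp y) * (exp 1 * exp (- y))"
    using assms by (intro mult_mono[OF yn r]) auto
  also have "\<dots> = exp 1 * (2 * \<gamma>) powr \<gamma>"
    by (simp add: exp_minus)
  finally show ?thesis
    using x by (simp add: field_simps)
qed

text \<open>
  The exponent at which \<open>n \<mapsto> (n + 1) powr \<gamma> * r ^ n\<close> and \<open>n \<mapsto> ln (n + 2) * r ^ n\<close> come within
  a constant factor of their suprema: \<open>n\<close> about \<open>1 / (2 (1 - r))\<close>. There Bernoulli's inequality keeps
  \<open>r ^ n\<close> above one half.
\<close>

lemma exists_power_ge_half:
  fixes r :: real
  assumes "0 \<le> r" "r < 1"
  obtains n :: nat where "1 / 2 \<le> r ^ n" "1 / (1 - r\<^sup>2) \<le> 2 * (real n + 1)"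
proof
  define n where "n = nat \<lfloor>1 / (2 * (1 - r))\<rfloor>"
  have n: "real n \<le> 1 / (2 * (1 - r))" "1 / (2 * (1 - r)) \<le> real n + 1"
    using assms by (auto simp: n_def)
  have "1 / 2 \<le> 1 + real n * (r - 1)"
    using n(1) assms by (simp add: field_simps)
  also have "\<dots> \<le> r ^ n"
    using Bernoulli_inequality[of "r - 1" n] assms by simp
  finally show "1 / 2 \<le> r ^ n" .
  have "r\<^sup>2 \<le> r" using assms by (simp add: power2_eq_square mult_left_le)
  then have "1 / (1 - r\<^sup>2) \<le> 1 / (1 - r)"
    using assms by (intro divide_left_mono mult_pos_pos) auto
  also have "\<dots> \<le> 2 * (real n + 1)"
    using n(2) assms by (simp add: field_simps)
  finally show "1 / (1 - r\<^sup>2) \<le> 2 * (real n + 1)" .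
qed

lemma exists_Suc_powr_mult_power_ge:
  fixes \<gamma> r :: real
  assumes "0 < \<gamma>" "0 \<le> r" "r < 1"
  shows "\<exists>n. 1 / (1 - r\<^sup>2) powr \<gamma> \<le> 2 * 2 powr \<gamma> * ((real n + 1) powr \<gamma> * r ^ n)"
proof -
  obtain n :: nat where n: "1 / 2 \<le> r ^ n" "1 / (1 - r\<^sup>2) \<le> 2 * (real n + 1)"
    using exists_power_ge_half assms by blast
  have x: "0 < 1 - r\<^sup>2" using assms by (simp add: power_less_one_iff)
  have "1 / (1 - r\<^sup>2) powr \<gamma> = (1 / (1 - r\<^sup>2)) powr \<gamma>"
    using x by (simp add: powr_divide)
  also have "\<dots> \<le> (2 * (real n + 1)) powr \<gamma>"
    using n(2) assms x by (intro powr_mono2) auto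
  also have "\<dots> = 2 powr \<gamma> * (real n + 1) powr \<gamma>"
    by (simp only: powr_mult)
  also have "\<dots> \<le> 2 powr \<gamma> * (real n + 1) powr \<gamma> * (2 * r ^ n)"
    using n(1) by (simp add: mult_left_le)
  finally show ?thesis
    by (auto simp: mult_ac intro!: exI[of _ n])
qed

lemma ln_2_le_ln_weight:
  fixes r :: real
  assumes "0 \<le> r" "r < 1"
  shows "ln 2 \<le> ln (2 / (1 - r\<^sup>2))"
proof -
  have "0 < 1 - r\<^sup>2" using assms by (simp add: power_less_one_iff)
  then show ?thesis by (simp add: field_simps)
qed

text \<open>
  Multiply and divide \<open>n + 2\<close> by \<open>u = (1 - r\<^sup>2) / 2\<close> inside the logarithm. This splits off
  \<open>ln (2 / (1 - r\<^sup>2))\<close>; the rest is at most \<open>(n + 2) u\<close>, which \<open>r ^ n\<close> makes bounded by the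
  power estimate with exponent one.
\<close>

lemma ln_mult_power_le:
  fixes r :: real
  assumes "0 \<le> r" "r < 1"
  shows "ln (real n + 2) * r ^ n \<le> (1 + 2 * exp 1 / ln 2) * ln (2 / (1 - r\<^sup>2))"
proof -
  define L where "L = ln (2 / (1 - r\<^sup>2))"
  define u where "u = (1 - r\<^sup>2) / 2"
  have u: "0 < u" using assms by (simp add: u_def power_less_one_iff)
  have L: "ln 2 \<le> L" using ln_2_le_ln_weight assms by (simp add: L_def)
  then have L0: "0 \<le> L" using ln_gt_zero[of "2::real"] by linarith
  have L_u: "L = - ln u"
    using u by (simp add: L_def u_def ln_div)
  have "ln (real n + 2) = L + ln ((real n + 2) * u)"
    using u by (simp add: L_u ln_mult)
  also have "ln ((real n + 2) * u) \<le> (real n + 2) * u"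
    using u ln_le_minus_one[of "(real n + 2) * u"] by simp
  also have "\<dots> \<le> 2 * (real n + 1) * u"
    using u by (intro mult_right_mono) auto
  finally have "ln (real n + 2) * r ^ n \<le> (L + 2 * (real n + 1) * u) * r ^ n"
    using assms by (intro mult_right_mono) auto
  also have "\<dots> = L * r ^ n + 2 * u * ((real n + 1) * r ^ n)"
    by (simp add: algebra_simps)
  also have "\<dots> \<le> L * 1 + 2 * u * (exp 1 * 2 * (1 / (1 - r\<^sup>2)))"
    using Suc_powr_mult_power_le[of 1 r n] assms u L0
    by (intro add_mono mult_left_mono power_le_one) (auto simp: u_def)
  also have "\<dots> = L + 2 * exp 1"
    using u by (simp add: u_def field_simps)
  also have "\<dots> \<le> L + 2 * exp 1 / ln 2 * L"
    using L by (simp add: field_simps)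
  finally show ?thesis
    by (simp add: L_def algebra_simps)
qed

text \<open>
  At the exponent of \<open>exists_power_ge_half\<close>, \<open>2 / (1 - r\<^sup>2)\<close> is at most \<open>4 (n + 1)\<close>, hence at
  most \<open>(n + 2) ^ 3\<close>; this costs a factor three, and \<open>r ^ n \<ge> 1/2\<close> another factor two.
\<close>

lemma exists_ln_mult_power_ge:
  fixes r :: real
  assumes "0 \<le> r" "r < 1"
  shows "\<exists>n. ln (2 / (1 - r\<^sup>2)) \<le> 6 * (ln (real n + 2) * r ^ n)"
proof -
  obtain n :: nat where n: "1 / 2 \<le> r ^ n" "1 / (1 - r\<^sup>2) \<le> 2 * (real n + 1)"
    using exists_power_ge_half assms by blast
  have x: "0 < 1 - r\<^sup>2" using assms by (simp add: power_less_one_iff)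
  have "2 / (1 - r\<^sup>2) \<le> 2\<^sup>2 * (real n + 2)"
    using n(2) by simp
  also have "\<dots> \<le> (real n + 2)\<^sup>2 * (real n + 2)"
    by (intro mult_right_mono power_mono) auto
  also have "\<dots> = (real n + 2) ^ 3"
    by (simp add: power3_eq_cube power2_eq_square)
  finally have "ln (2 / (1 - r\<^sup>2)) \<le> ln ((real n + 2) ^ 3)"
    using x by (intro ln_mono) auto
  also have "\<dots> = 3 * ln (real n + 2)"
    by (subst ln_realpow) auto
  also have "\<dots> \<le> 3 * ln (real n + 2) * (2 * r ^ n)"
    using n(1) by (simp add: mult_left_le)
  finally show ?thesis
    by (auto simp: mult_ac intro!: exI[of _ n])
qed

section \<open>Zygmund norms and derivatives of the operator\<close>

lemma disk_weight_pos: "0 < 1 - (cmod z)\<^sup>2" if "z \<in> unit_disk"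
  using that by (simp add: power_less_one_iff)

lemma has_field_derivative_on_disk_imp_deriv:
  assumes F: "\<And>z. z \<in> unit_disk \<Longrightarrow> (F has_field_derivative h z) (at z)" and z: "z \<in> unit_disk"
  shows "deriv F z = h z" "deriv (deriv F) z = deriv h z"
proof -
  have eq: "deriv F w = h w" if "w \<in> unit_disk" for w
    using F[OF that] by (rule DERIV_imp_deriv)
  then show "deriv F z = h z" using z .
  show "deriv (deriv F) z = deriv h z"
    using eventually_nhds_in_open[OF open_ball z]
    by (intro deriv_cong_ev) (auto elim!: eventually_mono simp: eq)
qed

lemma disk_primitive:
  assumes "h holomorphic_on unit_disk"
  obtains F where "\<And>z. z \<in> unit_disk \<Longrightarrow> (F has_field_derivative h z) (at z)" "F 0 = 0"
proof -
  obtain F where F: "\<And>z. z \<in> unit_disk \<Longrightarrow> (F has_field_derivative h z) (at z within unit_disk)"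
    using holomorphic_convex_primitive'[OF convex_ball open_ball assms] by blast
  show thesis
  proof (rule that)
    show "((\<lambda>z. F z - F 0) has_field_derivative h z) (at z)" if "z \<in> unit_disk" for z
      using F[OF that] that by (auto simp: at_within_open[OF that] intro!: derivative_eq_intros)
  qed simp
qed

lemma zygmund_space_iff:
  "f \<in> zygmund_space \<alpha> \<longleftrightarrow> f holomorphic_on unit_disk \<and>
     (\<exists>M. \<forall>z\<in>unit_disk. (1 - (cmod z)\<^sup>2) powr \<alpha> * cmod (deriv (deriv f) z) \<le> M)"
  unfolding zygmund_space_def SUP_ennreal_less_top_iff by simp

lemma zygmund_norm_le:
  assumes "0 \<le> B"
    and "\<And>z. z \<in> unit_disk \<Longrightarrow> (1 - (cmod z)\<^sup>2) powr \<alpha> * cmod (deriv (deriv f) z) \<le> B"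
  shows "zygmund_norm \<alpha> f \<le> ennreal (cmod (f 0) + cmod (deriv f 0) + B)"
proof -
  have "(SUP z\<in>unit_disk. ennreal ((1 - (cmod z)\<^sup>2) powr \<alpha> * cmod (deriv (deriv f) z))) \<le> ennreal B"
    using assms by (intro SUP_least ennreal_leI)
  then show ?thesis
    using assms by (simp add: zygmund_norm_def add_left_mono)
qed

lemma zygmund_norm_leD:
  assumes "zygmund_norm \<alpha> f \<le> ennreal N" "0 \<le> N"
  shows "cmod (deriv f 0) \<le> N"
    and "z \<in> unit_disk \<Longrightarrow> (1 - (cmod z)\<^sup>2) powr \<alpha> * cmod (deriv (deriv f) z) \<le> N"
proof -
  let ?S = "SUP z\<in>unit_disk. ennreal ((1 - (cmod z)\<^sup>2) powr \<alpha> * cmod (deriv (deriv f) z))"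
  have "ennreal (cmod (deriv f 0)) \<le> zygmund_norm \<alpha> f"
    unfolding zygmund_norm_def by (simp add: add_increasing add_increasing2)
  also note assms(1)
  finally show "cmod (deriv f 0) \<le> N"
    using assms(2) by simp
  assume z: "z \<in> unit_disk"
  have "ennreal ((1 - (cmod z)\<^sup>2) powr \<alpha> * cmod (deriv (deriv f) z)) \<le> ?S"
    using z by (rule SUP_upper)
  also have "?S \<le> zygmund_norm \<alpha> f"
    unfolding zygmund_norm_def by (simp add: add_increasing)
  also note assms(1)
  finally show "(1 - (cmod z)\<^sup>2) powr \<alpha> * cmod (deriv (deriv f) z) \<le> N"
    using assms(2) by simp
qed

lemma zygmund_norm_finite:
  assumes "f \<in> zygmund_space \<alpha>"
  shows "zygmund_norm \<alpha> f < \<infinity>"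
  using assms by (simp add: zygmund_space_def zygmund_norm_def)

text \<open>
  The integrand is holomorphic on a convex set, so it has a primitive there, and the operator is
  the primitive that vanishes at the origin. The second derivative is where the two weighted
  quantities of the theorem come from.
\<close>

lemma VC_operator_on_disk:
  assumes \<phi>: "analytic_self_map \<phi>" and g: "g holomorphic_on unit_disk"
    and f: "f holomorphic_on unit_disk" and z: "z \<in> unit_disk"
  shows has_contour_integral_VC_operator:
      "((\<lambda>\<xi>. deriv f (\<phi> \<xi>) * g \<xi>) has_contour_integral VC_operator g \<phi> f z) (linepath 0 z)"
    and VC_operator_0: "VC_operator g \<phi> f 0 = 0"
    and has_field_derivative_VC_operator:
      "(VC_operator g \<phi> f has_field_derivative deriv f (\<phi> z) * g z) (at z)"
    and deriv_deriv_VC_operator: "deriv (deriv (VC_operator g \<phi> f)) z =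
      deriv (deriv f) (\<phi> z) * deriv \<phi> z * g z + deriv f (\<phi> z) * deriv g z"
proof -
  have \<phi>h: "\<phi> holomorphic_on unit_disk" and \<phi>i: "\<phi> ` unit_disk \<subseteq> unit_disk"
    using \<phi> by (auto simp: analytic_self_map_def)
  have f': "deriv f holomorphic_on unit_disk"
    using f by (intro holomorphic_deriv) auto
  have "(\<lambda>\<xi>. deriv f (\<phi> \<xi>)) holomorphic_on unit_disk"
    using holomorphic_on_compose_gen[OF \<phi>h f' \<phi>i] by (simp add: o_def)
  then have hol: "(\<lambda>\<xi>. deriv f (\<phi> \<xi>) * g \<xi>) holomorphic_on unit_disk"
    using g by (rule holomorphic_on_mult)
  then obtain F where F: "\<And>z. z \<in> unit_disk \<Longrightarrow> (F has_field_derivative deriv f (\<phi> z) * g z) (at z)"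
    and F0: "F 0 = 0"
    using disk_primitive by blast
  have seg: "((\<lambda>\<xi>. deriv f (\<phi> \<xi>) * g \<xi>) has_contour_integral F w) (linepath 0 w)"
    if w: "w \<in> unit_disk" for w
  proof -
    have "path_image (linepath 0 w) \<subseteq> unit_disk"
      using w by (simp add: closed_segment_subset)
    then show ?thesis
      using contour_integral_primitive[of unit_disk F "\<lambda>\<xi>. deriv f (\<phi> \<xi>) * g \<xi>" "linepath 0 w"]
        F F0 by (auto intro: has_field_derivative_at_within)
  qed
  have VC: "VC_operator g \<phi> f w = F w" if "w \<in> unit_disk" for w
    using contour_integral_unique[OF seg[OF that]] by (simp add: VC_operator_def)
  show "((\<lambda>\<xi>. deriv f (\<phi> \<xi>) * g \<xi>) has_contour_integral VC_operator g \<phi> f z) (linepath 0 z)"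
    using seg[OF z] VC[OF z] by simp
  show "VC_operator g \<phi> f 0 = 0" using VC[of 0] F0 by simp
  have D: "(VC_operator g \<phi> f has_field_derivative deriv f (\<phi> w) * g w) (at w)" if w: "w \<in> unit_disk" for w
    using F[OF w] open_ball w by (rule has_field_derivative_transform_within_open) (simp add: VC)
  then show "(VC_operator g \<phi> f has_field_derivative deriv f (\<phi> z) * g z) (at z)" using z .
  have "(\<phi> has_field_derivative deriv \<phi> z) (at z)" "(g has_field_derivative deriv g z) (at z)"
    using \<phi>h g z holomorphic_derivI open_ball by blast+
  moreover have "(deriv f has_field_derivative deriv (deriv f) (\<phi> z)) (at (\<phi> z))"
    using holomorphic_derivI[OF f' open_ball, of "\<phi> z"] imageI[OF z, of \<phi>] \<phi>i by blast
  ultimately have "((\<lambda>\<xi>. deriv f (\<phi> \<xi>) * g \<xi>) has_field_derivative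
      deriv (deriv f) (\<phi> z) * deriv \<phi> z * g z + deriv f (\<phi> z) * deriv g z) (at z)"
    by (auto intro!: derivative_eq_intros DERIV_chain2[of "deriv f"] simp: algebra_simps)
  then show "deriv (deriv (VC_operator g \<phi> f)) z =
      deriv (deriv f) (\<phi> z) * deriv \<phi> z * g z + deriv f (\<phi> z) * deriv g z"
    using has_field_derivative_on_disk_imp_deriv(2)[OF D z] DERIV_imp_deriv by metis
qed

lemma VC_operator_linear:
  assumes \<phi>: "analytic_self_map \<phi>" and g: "g holomorphic_on unit_disk"
    and f: "f holomorphic_on unit_disk" and h: "h holomorphic_on unit_disk" and z: "z \<in> unit_disk"
  shows "VC_operator g \<phi> (\<lambda>w. a * f w + b * h w) z = a * VC_operator g \<phi> f z + b * VC_operator g \<phi> h z"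
proof -
  have "((\<lambda>\<xi>. a * (deriv f (\<phi> \<xi>) * g \<xi>) + b * (deriv h (\<phi> \<xi>) * g \<xi>)) has_contour_integral
      a * VC_operator g \<phi> f z + b * VC_operator g \<phi> h z) (linepath 0 z)"
    using has_contour_integral_VC_operator[OF \<phi> g f z] has_contour_integral_VC_operator[OF \<phi> g h z]
    by (intro has_contour_integral_add has_contour_integral_lmul)
  moreover have "a * (deriv f (\<phi> \<xi>) * g \<xi>) + b * (deriv h (\<phi> \<xi>) * g \<xi>) =
      deriv (\<lambda>w. a * f w + b * h w) (\<phi> \<xi>) * g \<xi>" if "\<xi> \<in> path_image (linepath 0 z)" for \<xi>
  proof -
    have "closed_segment 0 z \<subseteq> unit_disk"
      using z by (simp add: closed_segment_subset)
    then have "\<phi> \<xi> \<in> unit_disk"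
      using that \<phi> unfolding analytic_self_map_def by (metis image_subset_iff path_image_linepath subsetD)
    then have "(f has_field_derivative deriv f (\<phi> \<xi>)) (at (\<phi> \<xi>))"
        "(h has_field_derivative deriv h (\<phi> \<xi>)) (at (\<phi> \<xi>))"
      using f h holomorphic_derivI open_ball by blast+
    then have "deriv (\<lambda>w. a * f w + b * h w) (\<phi> \<xi>) = a * deriv f (\<phi> \<xi>) + b * deriv h (\<phi> \<xi>)"
      by (intro DERIV_imp_deriv) (auto intro!: derivative_eq_intros)
    then show ?thesis by (simp add: algebra_simps)
  qed
  ultimately have "((\<lambda>\<xi>. deriv (\<lambda>w. a * f w + b * h w) (\<phi> \<xi>) * g \<xi>) has_contour_integral
      a * VC_operator g \<phi> f z + b * VC_operator g \<phi> h z) (linepath 0 z)"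
    by (rule has_contour_integral_eq)
  then show ?thesis
    unfolding VC_operator_def[of g \<phi> "\<lambda>w. a * f w + b * h w"] by (rule contour_integral_unique)
qed

section \<open>Growth of the derivative of a Zygmund function\<close>

text \<open>
  The order, up to constants, of the largest \<open>\<bar>f' w\<bar>\<close> at a point \<open>\<bar>w\<bar> = r\<close> among the \<open>f\<close> in the
  unit ball of \<open>zygmund_space \<alpha>\<close>, that is, of one plus the integral of \<open>(1 - s) powr - \<alpha>\<close> over
  \<open>[0, r]\<close>.
\<close>

definition derivative_growth :: "real \<Rightarrow> real \<Rightarrow> real" where
  "derivative_growth \<alpha> r =
     (if \<alpha> < 1 then 1 else if \<alpha> = 1 then ln (2 / (1 - r\<^sup>2)) else 1 / (1 - r\<^sup>2) powr (\<alpha> - 1))"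

lemma derivative_growth_nonneg:
  assumes "0 \<le> r" "r < 1"
  shows "0 \<le> derivative_growth \<alpha> r"
  using ln_2_le_ln_weight[OF assms] ln_gt_zero[of "2::real"]
  by (simp add: derivative_growth_def del: ln_gt_zero_iff)

text \<open>
  Integrate the bound on \<open>h'\<close> along the radius to \<open>z\<close>, where \<open>1 - s\<^sup>2 \<ge> 1 - s\<close> lets the simpler
  weight \<open>(1 - s) powr \<alpha>\<close> be used. The mean value inequality against \<open>N * P\<close> replaces the integral.
\<close>

lemma norm_le_radial_primitive:
  fixes P :: "real \<Rightarrow> real"
  assumes h: "h holomorphic_on unit_disk" and \<alpha>: "0 < \<alpha>"
    and N: "cmod (h 0) \<le> N" "\<And>w. w \<in> unit_disk \<Longrightarrow> (1 - (cmod w)\<^sup>2) powr \<alpha> * cmod (deriv h w) \<le> N"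
    and P: "\<And>s. 0 \<le> s \<Longrightarrow> s < 1 \<Longrightarrow> (P has_real_derivative 1 / (1 - s) powr \<alpha>) (at s)"
    and z: "z \<in> unit_disk"
  shows "cmod (h z) \<le> N * (1 + P (cmod z) - P 0)"
proof -
  define r where "r = cmod z"
  have r: "0 \<le> r" "r < 1" using z by (auto simp: r_def)
  have N0: "0 \<le> N" using N(1) norm_ge_zero order_trans by blast
  have tr: "0 \<le> t * r" "t * r < 1" "t * r \<le> 1" if "0 \<le> t" "t \<le> 1" for t
    using that r mult_left_le_one_le[of r t] by auto
  have tz: "of_real t * z \<in> unit_disk" if "0 \<le> t" "t \<le> 1" for t
    using tr[OF that] that by (simp add: norm_mult r_def)
  have D1: "((\<lambda>t. h (of_real t * z)) has_vector_derivative (z * deriv h (of_real t * z))) (at t)"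
    if t: "0 \<le> t" "t \<le> 1" for t
  proof -
    have "(h has_field_derivative deriv h (of_real t * z)) (at (of_real t * z))"
      using holomorphic_derivI[OF h open_ball tz[OF t]] .
    moreover have "((\<lambda>t. of_real t * z) has_vector_derivative z) (at t)"
      by (auto intro!: derivative_eq_intros simp: has_vector_derivative_def scaleR_conv_of_real)
    ultimately show ?thesis
      using field_vector_diff_chain_at[of "\<lambda>t. of_real t * z" z t h] by (simp add: o_def)
  qed
  have D2: "((\<lambda>t. N * P (t * r)) has_vector_derivative (N * (r * (1 / (1 - t * r) powr \<alpha>)))) (at t)"
    if t: "0 \<le> t" "t \<le> 1" for t
  proof -
    have "((\<lambda>t. t * r) has_real_derivative r) (at t)"
      by (auto intro!: derivative_eq_intros)
    with P[OF tr(1,2)[OF t]]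
    have "((\<lambda>t. P (t * r)) has_real_derivative 1 / (1 - t * r) powr \<alpha> * r) (at t)"
      by (rule DERIV_chain2)
    from DERIV_cmult[OF this, of N] show ?thesis
      by (simp add: has_real_derivative_iff_has_vector_derivative mult_ac)
  qed
  have "norm (h (of_real 1 * z) - h (of_real 0 * z)) \<le> N * P (1 * r) - N * P (0 * r)"
  proof (rule differentiable_bound_general[OF zero_less_one])
    show "continuous_on {0..1} (\<lambda>t. h (of_real t * z))" "continuous_on {0..1} (\<lambda>t. N * P (t * r))"
      using D1 D2 by (auto intro!: continuous_at_imp_continuous_on has_vector_derivative_continuous)
    fix t :: real assume t: "0 < t" "t < 1"
    show "((\<lambda>t. h (of_real t * z)) has_vector_derivative (z * deriv h (of_real t * z))) (at t)"
      using D1 t by simp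
    show "((\<lambda>t. N * P (t * r)) has_vector_derivative (N * (r * (1 / (1 - t * r) powr \<alpha>)))) (at t)"
      using D2 t by simp
    have w: "of_real t * z \<in> unit_disk" using tz t by simp
    have tr': "0 \<le> t * r" "t * r < 1" using tr[of t] t by auto
    have "(1 - t * r) powr \<alpha> * cmod (deriv h (of_real t * z))
        \<le> (1 - (cmod (of_real t * z))\<^sup>2) powr \<alpha> * cmod (deriv h (of_real t * z))"
    proof (intro mult_right_mono powr_mono2)
      have "(t * r)\<^sup>2 \<le> t * r"
        using tr' by (simp add: power2_eq_square mult_left_le)
      then show "1 - t * r \<le> 1 - (cmod (of_real t * z))\<^sup>2"
        using t by (simp add: norm_mult r_def)
    qed (use tr' \<alpha> in auto)
    also have "\<dots> \<le> N" using N(2) w .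
    finally have "cmod (deriv h (of_real t * z)) \<le> N * (1 / (1 - t * r) powr \<alpha>)"
      using tr' by (simp add: field_simps)
    from mult_left_mono[OF this r(1)]
    show "norm (z * deriv h (of_real t * z)) \<le> N * (r * (1 / (1 - t * r) powr \<alpha>))"
      by (simp add: norm_mult r_def mult_ac)
  qed
  then have "cmod (h z - h 0) \<le> N * P r - N * P 0" by simp
  then have "cmod (h z) \<le> N + (N * P r - N * P 0)"
    using N(1) norm_triangle_sub[of "h z" "h 0"] by linarith
  then show ?thesis by (simp add: r_def algebra_simps)
qed

text \<open>
  The three cases of \<open>derivative_growth\<close> are the three behaviours of the primitive of
  \<open>(1 - s) powr - \<alpha>\<close> at \<open>s = 1\<close>: bounded, logarithmic, and of order \<open>(1 - s) powr (1 - \<alpha>)\<close>.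
\<close>

lemma norm_le_derivative_growth:
  assumes \<alpha>: "0 < \<alpha>"
  obtains C where "0 < C" and
    "\<And>h N z. \<lbrakk>h holomorphic_on unit_disk; cmod (h 0) \<le> N;
       \<And>w. w \<in> unit_disk \<Longrightarrow> (1 - (cmod w)\<^sup>2) powr \<alpha> * cmod (deriv h w) \<le> N; z \<in> unit_disk\<rbrakk>
       \<Longrightarrow> cmod (h z) \<le> N * (C * derivative_growth \<alpha> (cmod z))"
proof -
  have "\<exists>C P. 0 < C \<and> (\<forall>s. 0 \<le> s \<longrightarrow> s < 1 \<longrightarrow>
      (P has_real_derivative 1 / (1 - s) powr \<alpha>) (at s) \<and> 1 + P s - P 0 \<le> C * derivative_growth \<alpha> s)"
  proof (cases "\<alpha> = 1")
    case True
    show ?thesis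
    proof (intro exI conjI allI impI)
      fix s :: real assume s: "0 \<le> s" "s < 1"
      show "((\<lambda>s. - ln (1 - s)) has_real_derivative 1 / (1 - s) powr \<alpha>) (at s)"
        using s True by (auto intro!: derivative_eq_intros simp: field_simps)
      have x: "0 < 1 - s\<^sup>2" using s by (simp add: power_less_one_iff)
      have "1 - s\<^sup>2 \<le> 2 * (1 - s)"
        using zero_le_power2[of "1 - s"] by (simp add: power2_eq_square algebra_simps)
      then have "1 / (1 - s) \<le> 2 / (1 - s\<^sup>2)"
        using s x by (simp add: field_simps)
      then have "ln (1 / (1 - s)) \<le> ln (2 / (1 - s\<^sup>2))"
        using s x by (intro ln_mono) auto
      then have "- ln (1 - s) \<le> ln (2 / (1 - s\<^sup>2))"
        using s by (simp add: ln_div)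
      moreover have "1 \<le> 1 / ln 2 * ln (2 / (1 - s\<^sup>2))"
        using ln_2_le_ln_weight[OF s] by (simp add: le_divide_eq)
      ultimately have "1 + - ln (1 - s) \<le> (1 + 1 / ln 2) * ln (2 / (1 - s\<^sup>2))"
        unfolding distrib_right mult_1_left by linarith
      then show "1 + - ln (1 - s) - - ln (1 - 0) \<le> (1 + 1 / ln 2) * derivative_growth \<alpha> s"
        using True by (simp add: derivative_growth_def)
    qed (simp add: add_pos_pos)
  next
    case False
    let ?P = "\<lambda>s. (1 - s) powr (1 - \<alpha>) / (\<alpha> - 1)"
    have D: "(?P has_real_derivative 1 / (1 - s) powr \<alpha>) (at s)" if "s < 1" for s
    proof -
      have "((\<lambda>s. 1 - s) has_real_derivative - 1) (at s)"
        by (auto intro!: derivative_eq_intros)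
      from DERIV_cdivide[OF DERIV_fun_powr[OF this, of "1 - \<alpha>"], of "\<alpha> - 1"]
      have "(?P has_real_derivative (1 - \<alpha>) * (1 - s) powr (- \<alpha>) * - 1 / (\<alpha> - 1)) (at s)"
        using that by simp
      moreover have "(1 - \<alpha>) * (1 - s) powr (- \<alpha>) * - 1 / (\<alpha> - 1) = 1 / (1 - s) powr \<alpha>"
        using False that by (simp add: powr_minus_divide divide_simps)
      ultimately show ?thesis by simp
    qed
    show ?thesis
    proof (cases "\<alpha> < 1")
      case True
      have "1 + ?P s - ?P 0 \<le> (1 + 1 / (1 - \<alpha>)) * derivative_growth \<alpha> s" if "s < 1" for s
      proof -
        have "?P s \<le> 0" using True by (simp add: divide_nonneg_neg)
        moreover have "- ?P 0 = 1 / (1 - \<alpha>)" using True by (simp add: field_simps)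
        ultimately show ?thesis using True by (simp add: derivative_growth_def)
      qed
      moreover have "0 < 1 + 1 / (1 - \<alpha>)" using True by (simp add: add_pos_pos)
      ultimately show ?thesis using D by blast
    next
      case False
      with \<open>\<alpha> \<noteq> 1\<close> have \<alpha>1: "1 < \<alpha>" by simp
      have "1 + ?P s - ?P 0 \<le> (1 + 2 powr (\<alpha> - 1) / (\<alpha> - 1)) * derivative_growth \<alpha> s"
        if s: "0 \<le> s" "s < 1" for s
      proof -
        have x: "0 < 1 - s\<^sup>2" using s by (simp add: power_less_one_iff)
        have "1 - s\<^sup>2 \<le> 2 * (1 - s)"
          using zero_le_power2[of "1 - s"] by (simp add: power2_eq_square algebra_simps)
        then have "(1 - s\<^sup>2) powr (\<alpha> - 1) \<le> (2 * (1 - s)) powr (\<alpha> - 1)"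
          using x \<alpha>1 by (intro powr_mono2) auto
        also have "\<dots> = 2 powr (\<alpha> - 1) * (1 - s) powr (\<alpha> - 1)"
          by (rule powr_mult)
        finally have "1 / (1 - s) powr (\<alpha> - 1) \<le> 2 powr (\<alpha> - 1) * (1 / (1 - s\<^sup>2) powr (\<alpha> - 1))"
          using s x by (simp add: field_simps)
        then have "(1 - s) powr (1 - \<alpha>) \<le> 2 powr (\<alpha> - 1) * (1 / (1 - s\<^sup>2) powr (\<alpha> - 1))"
          using powr_minus_divide[of "1 - s" "\<alpha> - 1"] by simp
        then have "?P s \<le> 2 powr (\<alpha> - 1) * (1 / (1 - s\<^sup>2) powr (\<alpha> - 1)) / (\<alpha> - 1)"
          using \<alpha>1 by (intro divide_right_mono) auto
        then have "?P s \<le> 2 powr (\<alpha> - 1) / (\<alpha> - 1) * (1 / (1 - s\<^sup>2) powr (\<alpha> - 1))"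
          by (simp add: mult_ac)
        moreover have "1 \<le> 1 / (1 - s\<^sup>2) powr (\<alpha> - 1)"
          using x \<alpha>1 powr_le_one_le powr_mono2[of "\<alpha> - 1" "1 - s\<^sup>2" 1] by simp
        moreover have "0 \<le> ?P 0" using \<alpha>1 by simp
        ultimately have "1 + ?P s - ?P 0
            \<le> 1 / (1 - s\<^sup>2) powr (\<alpha> - 1) + 2 powr (\<alpha> - 1) / (\<alpha> - 1) * (1 / (1 - s\<^sup>2) powr (\<alpha> - 1))"
          by linarith
        also have "\<dots> = (1 + 2 powr (\<alpha> - 1) / (\<alpha> - 1)) * (1 / (1 - s\<^sup>2) powr (\<alpha> - 1))"
          by (simp only: distrib_right mult_1_left)
        finally show ?thesis using \<alpha>1 by (simp add: derivative_growth_def)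
      qed
      moreover have "0 < 1 + 2 powr (\<alpha> - 1) / (\<alpha> - 1)" using \<alpha>1 by (simp add: add_pos_pos)
      ultimately show ?thesis using D by blast
    qed
  qed
  then obtain C P where C: "0 < C"
    and P: "\<And>s. 0 \<le> s \<Longrightarrow> s < 1 \<Longrightarrow> (P has_real_derivative 1 / (1 - s) powr \<alpha>) (at s)"
    and PC: "\<And>s. 0 \<le> s \<Longrightarrow> s < 1 \<Longrightarrow> 1 + P s - P 0 \<le> C * derivative_growth \<alpha> s"
    by blast
  show thesis
  proof (rule that[OF C])
    fix h N z
    assume h: "h holomorphic_on unit_disk" "cmod (h 0) \<le> N"
      "\<And>w. w \<in> unit_disk \<Longrightarrow> (1 - (cmod w)\<^sup>2) powr \<alpha> * cmod (deriv h w) \<le> N" and z: "z \<in> unit_disk"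
    have "0 \<le> N" using h(2) norm_ge_zero order_trans by blast
    have "cmod (h z) \<le> N * (1 + P (cmod z) - P 0)"
      by (rule norm_le_radial_primitive[OF h(1) \<alpha> h(2,3) P z])
    also have "\<dots> \<le> N * (C * derivative_growth \<alpha> (cmod z))"
      using \<open>0 \<le> N\<close> z by (intro mult_left_mono PC) auto
    finally show "cmod (h z) \<le> N * (C * derivative_growth \<alpha> (cmod z))" .
  qed
qed

section \<open>Test functions\<close>

lemma mult_powr_minus_le:
  fixes x y p :: real
  assumes "0 \<le> x" "x \<le> 2 * y" "0 < y" "0 \<le> p"
  shows "x powr p * y powr - p \<le> 2 powr p"
proof -
  have "x powr p \<le> (2 * y) powr p"
    using assms by (intro powr_mono2) auto
  also have "\<dots> = 2 powr p * y powr p"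
    using assms by (simp add: powr_mult)
  finally show ?thesis
    using assms by (simp add: powr_minus_divide divide_le_eq)
qed

text \<open>
  Powers of \<open>1 - cnj a * w\<close> are the building blocks of the test functions. This base avoids the
  branch cut and, up to a factor two, dominates both \<open>1 - \<bar>a\<bar>\<^sup>2\<close> and \<open>1 - \<bar>w\<bar>\<^sup>2\<close>, which gives
  weighted bounds that are uniform in \<open>a\<close>.
\<close>

lemma one_minus_cnj_mult:
  assumes a: "a \<in> unit_disk" and w: "w \<in> unit_disk"
  shows "1 - cnj a * w \<notin> \<real>\<^sub>\<le>\<^sub>0" "0 < cmod (1 - cnj a * w)"
    "1 - (cmod a)\<^sup>2 \<le> 2 * cmod (1 - cnj a * w)" "1 - (cmod w)\<^sup>2 \<le> 2 * cmod (1 - cnj a * w)"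
proof -
  have 1: "1 - cmod a * cmod w \<le> cmod (1 - cnj a * w)"
    using norm_triangle_ineq2[of 1 "cnj a * w"] by (simp add: norm_mult)
  have 2: "1 - (cmod u)\<^sup>2 \<le> 2 * (1 - cmod u)" for u
    using zero_le_power2[of "1 - cmod u"] by (simp add: power2_eq_square algebra_simps)
  have aw: "cmod a * cmod w \<le> cmod a" "cmod a * cmod w \<le> cmod w"
    using a w by (auto intro: mult_left_le mult_left_le_one_le)
  have "1 - cmod a \<le> cmod (1 - cnj a * w)" "1 - cmod w \<le> cmod (1 - cnj a * w)"
    using 1 aw by simp_all
  then show "1 - (cmod a)\<^sup>2 \<le> 2 * cmod (1 - cnj a * w)" "1 - (cmod w)\<^sup>2 \<le> 2 * cmod (1 - cnj a * w)"
    using 2[of a] 2[of w] by simp_all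
  show "0 < cmod (1 - cnj a * w)"
    using 1 aw a unfolding mem_ball_0 by linarith
  have "Re (cnj a * w) \<le> cmod a * cmod w"
    using complex_Re_le_cmod[of "cnj a * w"] by (simp add: norm_mult)
  then have "0 < Re (1 - cnj a * w)"
    using aw a unfolding mem_ball_0 minus_complex.sel one_complex.sel by linarith
  then show "1 - cnj a * w \<notin> \<real>\<^sub>\<le>\<^sub>0"
    using complex_nonpos_Reals_iff by auto
qed

lemma kernel_at_pole_conjugate: "1 - cnj a * a = of_real (1 - (cmod a)\<^sup>2)"
  by (simp only: of_real_diff of_real_1 complex_norm_square mult.commute)

lemma has_field_derivative_kernel_powr:
  assumes "a \<in> unit_disk" "w \<in> unit_disk"
  shows "((\<lambda>w. (1 - cnj a * w) powr of_real s) has_field_derivative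
           - (cnj a * of_real s * (1 - cnj a * w) powr of_real (s - 1))) (at w)"
proof -
  have "((\<lambda>w. 1 - cnj a * w) has_field_derivative - cnj a) (at w)"
    by (auto intro!: derivative_eq_intros)
  from DERIV_chain2[OF has_field_derivative_powr[OF one_minus_cnj_mult(1)[OF assms], of "of_real s"] this]
  show ?thesis by (simp add: mult_ac)
qed

text \<open>
  A derivative \<open>h = f'\<close> that isolates the \<open>f''\<close> term at the point \<open>a\<close>. With \<open>c = 1 - \<bar>a\<bar>\<^sup>2\<close> and
  \<open>k w = 1 - cnj a * w\<close>, so that \<open>k a = c\<close>, the functions \<open>c * k powr - \<alpha>\<close> and
  \<open>c\<^sup>2 * k powr (- \<alpha> - 1)\<close> agree at \<open>a\<close>, while their derivatives there differ in the coefficients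
  \<open>\<alpha>\<close> and \<open>\<alpha> + 1\<close>: the difference \<open>h\<close> vanishes at \<open>a\<close> and \<open>h' a\<close> keeps its extremal size up to the
  factor \<open>\<bar>a\<bar>\<close>.
\<close>

lemma vanishing_test_function:
  assumes \<alpha>: "0 < \<alpha>" and a: "a \<in> unit_disk"
  obtains h h' where "\<And>w. w \<in> unit_disk \<Longrightarrow> (h has_field_derivative h' w) (at w)"
    and "h a = 0" and "cmod (h' a) = cmod a / (1 - (cmod a)\<^sup>2) powr \<alpha>" and "cmod (h 0) \<le> 2"
    and "\<And>w. w \<in> unit_disk \<Longrightarrow>
      (1 - (cmod w)\<^sup>2) powr \<alpha> * cmod (h' w) \<le> \<alpha> * (2 * 2 powr \<alpha>) + (\<alpha> + 1) * (4 * 2 powr \<alpha>)"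
proof -
  define x where "x w = 1 - (cmod w)\<^sup>2" for w :: complex
  have x_pos: "0 < x w" if "w \<in> unit_disk" for w
    using disk_weight_pos[OF that] by (simp add: x_def)
  define k where "k w = 1 - cnj a * w" for w
  define c where "c = complex_of_real (x a)"
  define h where "h w = c * k w powr of_real (- \<alpha>) - c\<^sup>2 * k w powr of_real (- \<alpha> - 1)" for w
  define h' where "h' w = cnj a * (of_real \<alpha> * c * k w powr of_real (- \<alpha> - 1)
      - of_real (\<alpha> + 1) * c\<^sup>2 * k w powr of_real (- \<alpha> - 2))" for w
  have ka: "k a = c"
    by (simp only: k_def c_def x_def kernel_at_pole_conjugate)
  have c_powr: "c * k a powr of_real (s - 1) = k a powr of_real s" for s
    using x_pos[OF a] powr_of_real[of "x a" "s - 1"] powr_of_real[of "x a" s] powr_diff[of "x a" s 1]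
    unfolding ka c_def by simp
  have xa1: "x a \<le> 1" by (simp add: x_def)
  have "h a = 0"
    using c_powr[of "- \<alpha>"] by (simp add: h_def power2_eq_square mult.assoc)
  moreover have "h' a = - cnj a * k a powr of_real (- \<alpha>)"
    using c_powr[of "- \<alpha>"] c_powr[of "- \<alpha> - 1"]
    by (simp add: h'_def power2_eq_square mult.assoc algebra_simps)
  moreover have "k a powr of_real (- \<alpha>) = of_real (1 / x a powr \<alpha>)"
    unfolding ka c_def using x_pos[OF a] by (subst powr_of_real) (auto simp: powr_minus_divide)
  ultimately have ha: "h a = 0" "cmod (h' a) = cmod a / x a powr \<alpha>"
    using x_pos[OF a] by (auto simp: norm_mult norm_divide)
  show thesis
  proof (rule that[of h h', OF _ ha(1) ha(2)[unfolded x_def]])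
    fix w assume w: "w \<in> unit_disk"
    note D = has_field_derivative_kernel_powr[OF a w, folded k_def]
    show "(h has_field_derivative h' w) (at w)"
      unfolding h_def
      by (rule derivative_eq_intros D refl)+ (simp add: h'_def algebra_simps)
    have k0: "0 < cmod (k w)" and ak: "x a \<le> 2 * cmod (k w)" and wk: "x w \<le> 2 * cmod (k w)"
      using one_minus_cnj_mult[OF a w] by (auto simp: k_def x_def)
    have n: "cmod (k w powr of_real s) = cmod (k w) powr s" for s
      by (simp add: norm_powr_real_powr')
    have W: "x w powr \<alpha> * cmod (k w) powr - \<alpha> \<le> 2 powr \<alpha>"
      using x_pos[OF w] k0 wk \<alpha> by (intro mult_powr_minus_le) auto
    have 1: "x w powr \<alpha> * (x a * cmod (k w) powr (- \<alpha> - 1)) \<le> 2 * 2 powr \<alpha>"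
    proof -
      have "x w powr \<alpha> * (x a * cmod (k w) powr (- \<alpha> - 1))
          = (x a / cmod (k w)) * (x w powr \<alpha> * cmod (k w) powr - \<alpha>)"
        using k0 by (simp add: powr_diff)
      also have "\<dots> \<le> 2 * 2 powr \<alpha>"
        using W k0 ak x_pos[OF a] by (intro mult_mono) (auto simp: divide_le_eq)
      finally show ?thesis .
    qed
    have 2: "x w powr \<alpha> * ((x a)\<^sup>2 * cmod (k w) powr (- \<alpha> - 2)) \<le> 4 * 2 powr \<alpha>"
    proof -
      have "x w powr \<alpha> * ((x a)\<^sup>2 * cmod (k w) powr (- \<alpha> - 2))
          = (x a / cmod (k w))\<^sup>2 * (x w powr \<alpha> * cmod (k w) powr - \<alpha>)"
        using k0 by (simp add: powr_diff power_divide)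
      also have "\<dots> \<le> 2\<^sup>2 * 2 powr \<alpha>"
        using W k0 ak x_pos[OF a] by (intro mult_mono power_mono) (auto simp: divide_le_eq)
      finally show ?thesis by simp
    qed
    have c: "cmod c = x a" using x_pos[OF a] by (simp add: c_def)
    have "cmod (h' w) = cmod a * cmod (of_real \<alpha> * c * k w powr of_real (- \<alpha> - 1)
        - of_real (\<alpha> + 1) * c\<^sup>2 * k w powr of_real (- \<alpha> - 2))"
      by (simp add: h'_def norm_mult)
    also have "\<dots> \<le> 1 * (cmod (of_real \<alpha> * c * k w powr of_real (- \<alpha> - 1))
        + cmod (of_real (\<alpha> + 1) * c\<^sup>2 * k w powr of_real (- \<alpha> - 2)))"
      using a by (intro mult_mono norm_triangle_ineq4) auto
    also have "\<dots> = \<alpha> * (x a * cmod (k w) powr (- \<alpha> - 1))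
        + (\<alpha> + 1) * ((x a)\<^sup>2 * cmod (k w) powr (- \<alpha> - 2))"
      unfolding norm_mult norm_power n c norm_of_real using \<alpha> by simp
    finally have "x w powr \<alpha> * cmod (h' w) \<le> x w powr \<alpha> * (\<alpha> * (x a * cmod (k w) powr (- \<alpha> - 1))
        + (\<alpha> + 1) * ((x a)\<^sup>2 * cmod (k w) powr (- \<alpha> - 2)))"
      by (rule mult_left_mono) simp
    also have "\<dots> = \<alpha> * (x w powr \<alpha> * (x a * cmod (k w) powr (- \<alpha> - 1)))
        + (\<alpha> + 1) * (x w powr \<alpha> * ((x a)\<^sup>2 * cmod (k w) powr (- \<alpha> - 2)))"
      by (simp add: algebra_simps)
    also have "\<dots> \<le> \<alpha> * (2 * 2 powr \<alpha>) + (\<alpha> + 1) * (4 * 2 powr \<alpha>)"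
      using 1 2 \<alpha> by (intro add_mono mult_left_mono) auto
    finally show "(1 - (cmod w)\<^sup>2) powr \<alpha> * cmod (h' w) \<le> \<alpha> * (2 * 2 powr \<alpha>) + (\<alpha> + 1) * (4 * 2 powr \<alpha>)"
      by (simp add: x_def)
  next
    have "cmod (h 0) \<le> cmod c + cmod (c\<^sup>2)"
      using norm_triangle_ineq4[of c "c\<^sup>2"] by (simp add: h_def k_def)
    also have "\<dots> \<le> 1 + 1"
      using x_pos[OF a] xa1 by (intro add_mono) (auto simp: c_def norm_power power_le_one)
    finally show "cmod (h 0) \<le> 2" by simp
  qed
qed

text \<open>
  A derivative \<open>h = f'\<close> that attains the growth bound at \<open>a\<close>: a constant, \<open>ln 2 - Ln (1 - cnj a * w)\<close>
  or \<open>(1 - cnj a * w) powr (1 - \<alpha>)\<close>. The order of \<open>h' a\<close> is all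
  that is recorded about it, because the \<open>f''\<close> term is controlled beforehand.
\<close>

lemma growth_test_function:
  assumes \<alpha>: "0 < \<alpha>" and a: "a \<in> unit_disk"
  obtains h h' where "\<And>w. w \<in> unit_disk \<Longrightarrow> (h has_field_derivative h' w) (at w)"
    and "cmod (h a) = derivative_growth \<alpha> (cmod a)"
    and "cmod (h' a) \<le> \<alpha> * (1 / (1 - (cmod a)\<^sup>2) powr \<alpha>)" and "cmod (h 0) \<le> 1"
    and "\<And>w. w \<in> unit_disk \<Longrightarrow> (1 - (cmod w)\<^sup>2) powr \<alpha> * cmod (h' w) \<le> \<alpha> * 2 powr \<alpha>"
proof -
  have ka: "cmod (1 - cnj a * a) = 1 - (cmod a)\<^sup>2"
    using disk_weight_pos[OF a] unfolding kernel_at_pole_conjugate norm_of_real by simp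
  consider "\<alpha> < 1" | "\<alpha> = 1" | "1 < \<alpha>" by linarith
  then show thesis
  proof cases
    case 1
    show thesis
      using 1 \<alpha> by (intro that[of "\<lambda>_. 1" "\<lambda>_. 0"]) (auto simp: derivative_growth_def)
  next
    case 2
    show thesis
    proof (rule that[of "\<lambda>w. of_real (ln 2) - Ln (1 - cnj a * w)" "\<lambda>w. cnj a / (1 - cnj a * w)"])
      show "cmod (of_real (ln 2) - Ln (1 - cnj a * a)) = derivative_growth \<alpha> (cmod a)"
        using disk_weight_pos[OF a] 2 derivative_growth_nonneg[of "cmod a" \<alpha>] a
        unfolding kernel_at_pole_conjugate
        by (simp add: Ln_of_real derivative_growth_def ln_div flip: of_real_diff)
      show "cmod (cnj a / (1 - cnj a * a)) \<le> \<alpha> * (1 / (1 - (cmod a)\<^sup>2) powr \<alpha>)"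
        unfolding norm_divide ka using a disk_weight_pos[OF a] 2 by (simp add: divide_right_mono)
      show "cmod (of_real (ln 2) - Ln (1 - cnj a * 0)) \<le> 1"
        using ln_2_less_1 by simp
      fix w assume w: "w \<in> unit_disk"
      note k = one_minus_cnj_mult[OF a w]
      show "((\<lambda>w. of_real (ln 2) - Ln (1 - cnj a * w)) has_field_derivative cnj a / (1 - cnj a * w)) (at w)"
        using k(1) by (auto intro!: derivative_eq_intros simp: field_simps)
      have "(1 - (cmod w)\<^sup>2) * cmod a \<le> 2 * cmod (1 - cnj a * w) * 1"
        using k a disk_weight_pos[OF w] by (intro mult_mono) auto
      then show "(1 - (cmod w)\<^sup>2) powr \<alpha> * cmod (cnj a / (1 - cnj a * w)) \<le> \<alpha> * 2 powr \<alpha>"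
        using k(2) disk_weight_pos[OF w] 2 by (simp add: norm_divide divide_le_eq)
    qed
  next
    case 3
    define h where "h w = (1 - cnj a * w) powr of_real (1 - \<alpha>)" for w
    define h' where "h' w = - (cnj a * of_real (1 - \<alpha>) * (1 - cnj a * w) powr of_real (1 - \<alpha> - 1))" for w
    have n: "cmod (u powr of_real s) = cmod u powr s" for u s
      by (simp add: norm_powr_real_powr')
    have h'_le: "cmod (h' w) \<le> \<alpha> * cmod (1 - cnj a * w) powr - \<alpha>" for w
    proof -
      have "cmod (h' w) = (cmod a * (\<alpha> - 1)) * cmod (1 - cnj a * w) powr - \<alpha>"
        unfolding h'_def norm_minus_cancel norm_mult n norm_of_real using 3 by simp
      also have "cmod a * (\<alpha> - 1) \<le> 1 * \<alpha>"
        using a 3 by (intro mult_mono) auto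
      finally show ?thesis by (simp add: mult_right_mono)
    qed
    show thesis
    proof (rule that[of h h'])
      show "cmod (h a) = derivative_growth \<alpha> (cmod a)"
        using 3 powr_minus_divide[of "1 - (cmod a)\<^sup>2" "\<alpha> - 1"]
        unfolding h_def n ka by (simp add: derivative_growth_def)
      show "cmod (h' a) \<le> \<alpha> * (1 / (1 - (cmod a)\<^sup>2) powr \<alpha>)"
        using h'_le[of a] unfolding ka by (simp add: powr_minus_divide)
      show "cmod (h 0) \<le> 1" by (simp add: h_def)
      fix w assume w: "w \<in> unit_disk"
      show "(h has_field_derivative h' w) (at w)"
        unfolding h_def h'_def by (rule has_field_derivative_kernel_powr[OF a w])
      have "(1 - (cmod w)\<^sup>2) powr \<alpha> * cmod (h' w)
          \<le> (1 - (cmod w)\<^sup>2) powr \<alpha> * (\<alpha> * cmod (1 - cnj a * w) powr - \<alpha>)"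
        by (intro mult_left_mono h'_le) simp
      also have "\<dots> = \<alpha> * ((1 - (cmod w)\<^sup>2) powr \<alpha> * cmod (1 - cnj a * w) powr - \<alpha>)"
        by (rule mult.left_commute)
      also have "\<dots> \<le> \<alpha> * 2 powr \<alpha>"
        using one_minus_cnj_mult[OF a w] disk_weight_pos[OF w] \<alpha>
        by (intro mult_left_mono mult_powr_minus_le) auto
      finally show "(1 - (cmod w)\<^sup>2) powr \<alpha> * cmod (h' w) \<le> \<alpha> * 2 powr \<alpha>" .
    qed
  qed
qed

section \<open>Boundedness in terms of two weighted suprema\<close>

lemma holomorphic_onI_derivative:
  assumes "\<And>w. w \<in> S \<Longrightarrow> (h has_field_derivative h' w) (at w)"
  shows "h holomorphic_on S"
  using assms by (meson field_differentiable_at_within field_differentiable_def holomorphic_onI)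

text \<open>
  Boundedness applied to the primitive \<open>f\<close> of a test function \<open>h\<close>, with \<open>f 0 = 0\<close>. Test functions
  are therefore given by \<open>h = f'\<close>, and the norm of \<open>f\<close> is at most \<open>A + B\<close>.
\<close>

lemma bounded_VC_operator_pointwise:
  assumes bdd: "bounded_zygmund_operator \<alpha> \<beta> (VC_operator g \<phi>)"
    and \<phi>: "analytic_self_map \<phi>" and g: "g holomorphic_on unit_disk"
  obtains K where "0 \<le> K" and
    "\<And>h h' A B z. \<lbrakk>\<And>w. w \<in> unit_disk \<Longrightarrow> (h has_field_derivative h' w) (at w); cmod (h 0) \<le> A; 0 \<le> B;
       \<And>w. w \<in> unit_disk \<Longrightarrow> (1 - (cmod w)\<^sup>2) powr \<alpha> * cmod (h' w) \<le> B; z \<in> unit_disk\<rbrakk>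
       \<Longrightarrow> (1 - (cmod z)\<^sup>2) powr \<beta> * cmod (h' (\<phi> z) * deriv \<phi> z * g z + h (\<phi> z) * deriv g z)
           \<le> K * (A + B)"
proof -
  obtain K where K: "0 \<le> K"
    "\<And>f. f \<in> zygmund_space \<alpha> \<Longrightarrow>
      zygmund_norm \<beta> (VC_operator g \<phi> f) \<le> ennreal K * zygmund_norm \<alpha> f"
    using bdd unfolding bounded_zygmund_operator_def by blast
  show thesis
  proof (rule that[OF K(1)])
    fix h h' A B z
    assume h: "\<And>w. w \<in> unit_disk \<Longrightarrow> (h has_field_derivative h' w) (at w)"
      and A: "cmod (h 0) \<le> A" and B: "0 \<le> B"
      and bound: "\<And>w. w \<in> unit_disk \<Longrightarrow> (1 - (cmod w)\<^sup>2) powr \<alpha> * cmod (h' w) \<le> B"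
      and z: "z \<in> unit_disk"
    obtain F where F: "\<And>w. w \<in> unit_disk \<Longrightarrow> (F has_field_derivative h w) (at w)" "F 0 = 0"
      using disk_primitive[OF holomorphic_onI_derivative[OF h]] by blast
    have d: "deriv F w = h w" "deriv (deriv F) w = h' w" if "w \<in> unit_disk" for w
      using has_field_derivative_on_disk_imp_deriv[OF F(1) that] DERIV_imp_deriv[OF h[OF that]] by auto
    have Fh: "F holomorphic_on unit_disk"
      using F(1) by (rule holomorphic_onI_derivative)
    then have FZ: "F \<in> zygmund_space \<alpha>"
      using bound d unfolding zygmund_space_iff by (auto intro!: exI[of _ B])
    have "zygmund_norm \<alpha> F \<le> ennreal (cmod (F 0) + cmod (deriv F 0) + B)"
      using B bound d by (intro zygmund_norm_le) auto
    also have "\<dots> \<le> ennreal (A + B)"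
      using F(2) A d(1)[of 0] by (intro ennreal_leI) simp
    finally have "ennreal K * zygmund_norm \<alpha> F \<le> ennreal K * ennreal (A + B)"
      by (rule mult_left_mono) simp
    with K(2)[OF FZ] have "zygmund_norm \<beta> (VC_operator g \<phi> F) \<le> ennreal (K * (A + B))"
      using K(1) by (simp add: ennreal_mult')
    moreover have "0 \<le> K * (A + B)"
      using K(1) A B norm_ge_zero[of "h 0"] by (intro mult_nonneg_nonneg) linarith+
    ultimately have "(1 - (cmod z)\<^sup>2) powr \<beta> * cmod (deriv (deriv (VC_operator g \<phi> F)) z) \<le> K * (A + B)"
      using z by (rule zygmund_norm_leD)
    moreover have "\<phi> z \<in> unit_disk"
      using \<phi> z unfolding analytic_self_map_def by blast
    ultimately show "(1 - (cmod z)\<^sup>2) powr \<beta> * cmod (h' (\<phi> z) * deriv \<phi> z * g z + h (\<phi> z) * deriv g z)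
        \<le> K * (A + B)"
      using deriv_deriv_VC_operator[OF \<phi> g Fh z] d by simp
  qed
qed

text \<open>
  Insert the bounds on \<open>f''\<close> and \<open>f'\<close> that membership in the space gives, at the point \<open>\<phi> z\<close>, into
  the formula for the second derivative of the image.
\<close>

lemma bounded_VC_operatorI:
  assumes \<alpha>: "0 < \<alpha>" and \<phi>: "analytic_self_map \<phi>" and g: "g holomorphic_on unit_disk"
    and M1: "\<And>z. z \<in> unit_disk \<Longrightarrow> (1 - (cmod z)\<^sup>2) powr \<beta> * (1 / (1 - (cmod (\<phi> z))\<^sup>2) powr \<alpha>) *
        cmod (g z * deriv \<phi> z) \<le> M1"
    and M2: "\<And>z. z \<in> unit_disk \<Longrightarrow> (1 - (cmod z)\<^sup>2) powr \<beta> * derivative_growth \<alpha> (cmod (\<phi> z)) *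
        cmod (deriv g z) \<le> M2"
  shows "bounded_zygmund_operator \<alpha> \<beta> (VC_operator g \<phi>)"
proof -
  obtain C where C: "0 < C" and growth:
    "\<And>h N z. \<lbrakk>h holomorphic_on unit_disk; cmod (h 0) \<le> N;
       \<And>w. w \<in> unit_disk \<Longrightarrow> (1 - (cmod w)\<^sup>2) powr \<alpha> * cmod (deriv h w) \<le> N; z \<in> unit_disk\<rbrakk>
       \<Longrightarrow> cmod (h z) \<le> N * (C * derivative_growth \<alpha> (cmod z))"
    using norm_le_derivative_growth[OF \<alpha>] by blast
  have \<phi>D: "\<phi> z \<in> unit_disk" if "z \<in> unit_disk" for z
    using \<phi> that unfolding analytic_self_map_def by blast
  define B where "B = M1 + C * M2"
  have M1_nonneg: "0 \<le> M1"
    by (rule order_trans[OF _ M1[of 0]]) auto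
  have M2_nonneg: "0 \<le> M2"
    using \<phi>D[of 0] by (intro order_trans[OF _ M2[of 0]]) (auto intro!: mult_nonneg_nonneg derivative_growth_nonneg)
  define K where "K = C * derivative_growth \<alpha> (cmod (\<phi> 0)) * cmod (g 0) + B"
  have K: "0 \<le> K"
    using C M1_nonneg M2_nonneg \<phi>D[of 0]
    by (auto simp: K_def B_def intro!: add_nonneg_nonneg mult_nonneg_nonneg derivative_growth_nonneg)
  have main: "VC_operator g \<phi> f \<in> zygmund_space \<beta> \<and>
      zygmund_norm \<beta> (VC_operator g \<phi> f) \<le> ennreal K * zygmund_norm \<alpha> f"
    if fZ: "f \<in> zygmund_space \<alpha>" for f
  proof -
    have f: "f holomorphic_on unit_disk" using fZ by (simp add: zygmund_space_iff)
    define N where "N = enn2real (zygmund_norm \<alpha> f)"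
    have N: "zygmund_norm \<alpha> f = ennreal N" "0 \<le> N"
      using zygmund_norm_finite[OF fZ] by (auto simp: N_def)
    note fN = zygmund_norm_leD[OF eq_refl[OF N(1)] N(2)]
    have f': "cmod (deriv f w) \<le> N * (C * derivative_growth \<alpha> (cmod w))" if "w \<in> unit_disk" for w
      using holomorphic_deriv[OF f open_ball] fN that by (intro growth)
    have VCb: "(1 - (cmod z)\<^sup>2) powr \<beta> * cmod (deriv (deriv (VC_operator g \<phi> f)) z) \<le> B * N"
      if z: "z \<in> unit_disk" for z
    proof -
      let ?w = "(1 - (cmod z)\<^sup>2) powr \<beta>"
      have x: "0 < 1 - (cmod (\<phi> z))\<^sup>2" using disk_weight_pos \<phi>D z by blast
      have "cmod (deriv (deriv f) (\<phi> z)) \<le> N * (1 / (1 - (cmod (\<phi> z))\<^sup>2) powr \<alpha>)"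
        using fN(2)[OF \<phi>D[OF z]] x by (simp add: field_simps)
      then have "?w * cmod (g z * deriv \<phi> z) * cmod (deriv (deriv f) (\<phi> z))
          \<le> ?w * cmod (g z * deriv \<phi> z) * (N * (1 / (1 - (cmod (\<phi> z))\<^sup>2) powr \<alpha>))"
        by (rule mult_left_mono) simp
      also have "\<dots> \<le> M1 * N"
        using mult_right_mono[OF M1[OF z] N(2)] by (simp add: mult_ac)
      finally have 1: "?w * cmod (deriv (deriv f) (\<phi> z) * deriv \<phi> z * g z) \<le> M1 * N"
        by (simp add: norm_mult mult_ac)
      have "?w * cmod (deriv g z) * cmod (deriv f (\<phi> z))
          \<le> ?w * cmod (deriv g z) * (N * (C * derivative_growth \<alpha> (cmod (\<phi> z))))"
        using f'[OF \<phi>D[OF z]] by (rule mult_left_mono) simp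
      also have "\<dots> \<le> C * M2 * N"
        using mult_right_mono[OF M2[OF z], of "C * N"] N(2) C by (simp add: mult_ac)
      finally have 2: "?w * cmod (deriv f (\<phi> z) * deriv g z) \<le> C * M2 * N"
        by (simp add: norm_mult mult_ac)
      have "?w * cmod (deriv (deriv (VC_operator g \<phi> f)) z)
          \<le> ?w * (cmod (deriv (deriv f) (\<phi> z) * deriv \<phi> z * g z) + cmod (deriv f (\<phi> z) * deriv g z))"
        unfolding deriv_deriv_VC_operator[OF \<phi> g f z] by (intro mult_left_mono norm_triangle_ineq) simp
      with 1 2 show ?thesis by (simp add: B_def distrib_left distrib_right)
    qed
    have hol: "VC_operator g \<phi> f holomorphic_on unit_disk"
      using has_field_derivative_VC_operator[OF \<phi> g f] by (rule holomorphic_onI_derivative)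
    have "deriv (VC_operator g \<phi> f) 0 = deriv f (\<phi> 0) * g 0"
      by (intro DERIV_imp_deriv has_field_derivative_VC_operator[OF \<phi> g f]) simp
    then have "cmod (deriv (VC_operator g \<phi> f) 0) \<le> N * (C * derivative_growth \<alpha> (cmod (\<phi> 0))) * cmod (g 0)"
      using f'[OF \<phi>D[of 0]] by (simp add: norm_mult mult_right_mono)
    moreover have "VC_operator g \<phi> f 0 = 0"
      using VC_operator_0[OF \<phi> g f, of 0] by simp
    moreover have "0 \<le> B * N"
      using C M1_nonneg M2_nonneg N(2) by (simp add: B_def)
    ultimately have "zygmund_norm \<beta> (VC_operator g \<phi> f) \<le> ennreal (K * N)"
      using VCb by (intro order_trans[OF zygmund_norm_le[of "B * N"]] ennreal_leI)
        (auto simp: K_def algebra_simps)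
    then show ?thesis
      using hol VCb K unfolding zygmund_space_iff N(1) by (auto simp: ennreal_mult' intro!: exI[of _ "B * N"])
  qed
  show ?thesis
    unfolding bounded_zygmund_operator_def
    using main K VC_operator_linear[OF \<phi> g] by (auto simp: zygmund_space_iff intro!: exI[of _ K])
qed

text \<open>
  The test functions \<open>1\<close> and \<open>w\<close> bound \<open>g'\<close> and \<open>g * \<phi>'\<close> in the plain weight
  \<open>(1 - \<bar>z\<bar>\<^sup>2) powr \<beta>\<close>, the vanishing test function at \<open>\<phi> z\<close> improves the bound for \<open>g * \<phi>'\<close> by the extremal size of \<open>f''\<close>,
  and with the \<open>f''\<close> term under control the growth test function at \<open>\<phi> z\<close> does the same for \<open>g'\<close>.
\<close>

lemma bounded_VC_operatorD:
  assumes \<alpha>: "0 < \<alpha>" and \<phi>: "analytic_self_map \<phi>" and g: "g holomorphic_on unit_disk"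
    and bdd: "bounded_zygmund_operator \<alpha> \<beta> (VC_operator g \<phi>)"
  obtains M1 M2 where
    "\<And>z. z \<in> unit_disk \<Longrightarrow> (1 - (cmod z)\<^sup>2) powr \<beta> * (1 / (1 - (cmod (\<phi> z))\<^sup>2) powr \<alpha>) *
        cmod (g z * deriv \<phi> z) \<le> M1"
    "\<And>z. z \<in> unit_disk \<Longrightarrow> (1 - (cmod z)\<^sup>2) powr \<beta> * derivative_growth \<alpha> (cmod (\<phi> z)) *
        cmod (deriv g z) \<le> M2"
proof -
  obtain K where K: "0 \<le> K" and test:
    "\<And>h h' A B z. \<lbrakk>\<And>w. w \<in> unit_disk \<Longrightarrow> (h has_field_derivative h' w) (at w); cmod (h 0) \<le> A; 0 \<le> B;
       \<And>w. w \<in> unit_disk \<Longrightarrow> (1 - (cmod w)\<^sup>2) powr \<alpha> * cmod (h' w) \<le> B; z \<in> unit_disk\<rbrakk>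
       \<Longrightarrow> (1 - (cmod z)\<^sup>2) powr \<beta> * cmod (h' (\<phi> z) * deriv \<phi> z * g z + h (\<phi> z) * deriv g z)
           \<le> K * (A + B)"
    using bounded_VC_operator_pointwise[OF bdd \<phi> g] by blast
  have \<phi>D: "\<phi> z \<in> unit_disk" if "z \<in> unit_disk" for z
    using \<phi> that unfolding analytic_self_map_def by blast
  define v where "v z = (1 - (cmod z)\<^sup>2) powr \<beta>" for z :: complex
  define x where "x w = 1 - (cmod w)\<^sup>2" for w :: complex
  have x_pos: "0 < x w" if "w \<in> unit_disk" for w
    using disk_weight_pos[OF that] by (simp add: x_def)
  have v: "0 \<le> v z" for z by (simp add: v_def)
  have g'_bound: "v z * cmod (deriv g z) \<le> K" if z: "z \<in> unit_disk" for z
    using test[of "\<lambda>_. 1" "\<lambda>_. 0" 1 0 z] z by (simp add: v_def)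
  have u_bound: "v z * cmod (g z * deriv \<phi> z) \<le> 2 * K" if z: "z \<in> unit_disk" for z
  proof -
    have "(1 - (cmod w)\<^sup>2) powr \<alpha> \<le> 1" if "w \<in> unit_disk" for w
      using disk_weight_pos[OF that] \<alpha> powr_mono2[of \<alpha> "1 - (cmod w)\<^sup>2" 1] by simp
    then have 1: "v z * cmod (deriv \<phi> z * g z + \<phi> z * deriv g z) \<le> K"
      using test[of "\<lambda>w. w" "\<lambda>_. 1" 0 1 z] z by (simp add: v_def)
    have "v z * cmod (\<phi> z * deriv g z) \<le> v z * cmod (deriv g z)"
      using v \<phi>D[OF z] by (intro mult_left_mono) (auto simp: norm_mult mult_left_le_one_le)
    then have 2: "v z * cmod (\<phi> z * deriv g z) \<le> K"
      using g'_bound[OF z] by linarith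
    have "v z * cmod (g z * deriv \<phi> z)
        \<le> v z * (cmod (deriv \<phi> z * g z + \<phi> z * deriv g z) + cmod (\<phi> z * deriv g z))"
      using norm_triangle_ineq4[of "deriv \<phi> z * g z + \<phi> z * deriv g z" "\<phi> z * deriv g z"] v
      by (intro mult_left_mono) (auto simp: mult.commute)
    with 1 2 show ?thesis by (simp add: distrib_left)
  qed
  define B where "B = \<alpha> * (2 * 2 powr \<alpha>) + (\<alpha> + 1) * (4 * 2 powr \<alpha>)"
  have B: "0 \<le> B" using \<alpha> by (simp add: B_def)
  have pole: "v z * cmod (g z * deriv \<phi> z) * (cmod (\<phi> z) / x (\<phi> z) powr \<alpha>) \<le> K * (2 + B)"
    if z: "z \<in> unit_disk" for z
  proof -
    obtain h h' where h: "\<And>w. w \<in> unit_disk \<Longrightarrow> (h has_field_derivative h' w) (at w)"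
        "cmod (h 0) \<le> 2"
        "\<And>w. w \<in> unit_disk \<Longrightarrow> (1 - (cmod w)\<^sup>2) powr \<alpha> * cmod (h' w) \<le> B"
      and ha: "h (\<phi> z) = 0" "cmod (h' (\<phi> z)) = cmod (\<phi> z) / x (\<phi> z) powr \<alpha>"
      using vanishing_test_function[OF \<alpha> \<phi>D[OF z]] unfolding B_def x_def by metis
    show ?thesis
      using test[OF h(1,2) B h(3) z] ha by (simp add: v_def norm_mult mult_ac)
  qed
  define M1 where "M1 = 2 * K * 2 powr \<alpha> + 2 * (K * (2 + B))"
  have M1: "v z * (1 / x (\<phi> z) powr \<alpha>) * cmod (g z * deriv \<phi> z) \<le> M1" if z: "z \<in> unit_disk" for z
  proof (cases "cmod (\<phi> z) \<le> 1 / 2")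
    \<comment> \<open>Near the origin the factor \<open>\<bar>\<phi> z\<bar>\<close> in \<open>pole\<close> is small, but the weight of \<open>\<phi> z\<close> is bounded below.\<close>
    case True
    then have "(cmod (\<phi> z))\<^sup>2 \<le> (1 / 2)\<^sup>2" by (intro power_mono) auto
    then have "1 / 2 \<le> x (\<phi> z)" by (simp add: x_def power2_eq_square)
    then have "(1 / 2) powr \<alpha> \<le> x (\<phi> z) powr \<alpha>" using \<alpha> by (intro powr_mono2) auto
    then have "1 / x (\<phi> z) powr \<alpha> \<le> 2 powr \<alpha>"
      using x_pos[OF \<phi>D[OF z]] by (simp add: powr_divide field_simps)
    from mult_mono[OF u_bound[OF z] this]
    have "v z * cmod (g z * deriv \<phi> z) * (1 / x (\<phi> z) powr \<alpha>) \<le> 2 * K * 2 powr \<alpha>"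
      using K by simp
    moreover have "0 \<le> 2 * (K * (2 + B))" using K B by simp
    ultimately show ?thesis unfolding M1_def by (simp add: mult_ac)
  next
    case False
    then have "1 / x (\<phi> z) powr \<alpha> \<le> 2 * (cmod (\<phi> z) / x (\<phi> z) powr \<alpha>)"
      using x_pos[OF \<phi>D[OF z]] by (simp add: divide_right_mono)
    then have "v z * cmod (g z * deriv \<phi> z) * (1 / x (\<phi> z) powr \<alpha>)
        \<le> v z * cmod (g z * deriv \<phi> z) * (2 * (cmod (\<phi> z) / x (\<phi> z) powr \<alpha>))"
      using v by (intro mult_left_mono) auto
    also have "\<dots> \<le> 2 * (K * (2 + B))"
      unfolding mult.left_commute[of _ 2] using pole[OF z] by simp
    also have "\<dots> \<le> M1" using K by (simp add: M1_def)
    finally show ?thesis by (simp add: mult_ac)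
  qed
  have M2: "v z * derivative_growth \<alpha> (cmod (\<phi> z)) * cmod (deriv g z) \<le> K * (1 + \<alpha> * 2 powr \<alpha>) + \<alpha> * M1"
    if z: "z \<in> unit_disk" for z
  proof -
    obtain h h' where h: "\<And>w. w \<in> unit_disk \<Longrightarrow> (h has_field_derivative h' w) (at w)"
        "cmod (h 0) \<le> 1"
        "\<And>w. w \<in> unit_disk \<Longrightarrow> (1 - (cmod w)\<^sup>2) powr \<alpha> * cmod (h' w) \<le> \<alpha> * 2 powr \<alpha>"
      and ha: "cmod (h (\<phi> z)) = derivative_growth \<alpha> (cmod (\<phi> z))"
        "cmod (h' (\<phi> z)) \<le> \<alpha> * (1 / x (\<phi> z) powr \<alpha>)"
      using growth_test_function[OF \<alpha> \<phi>D[OF z]] unfolding x_def by metis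
    have "0 \<le> \<alpha> * 2 powr \<alpha>" using \<alpha> by simp
    from test[OF h(1,2) this h(3) z]
    have 1: "v z * cmod (h' (\<phi> z) * deriv \<phi> z * g z + h (\<phi> z) * deriv g z) \<le> K * (1 + \<alpha> * 2 powr \<alpha>)"
      by (simp add: v_def)
    have "v z * cmod (g z * deriv \<phi> z) * cmod (h' (\<phi> z))
        \<le> v z * cmod (g z * deriv \<phi> z) * (\<alpha> * (1 / x (\<phi> z) powr \<alpha>))"
      using ha(2) v by (intro mult_left_mono) auto
    also have "\<dots> \<le> \<alpha> * M1"
      using mult_left_mono[OF M1[OF z], of \<alpha>] \<alpha> by (simp add: mult_ac)
    finally have 2: "v z * cmod (h' (\<phi> z) * deriv \<phi> z * g z) \<le> \<alpha> * M1"
      by (simp add: norm_mult mult_ac)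
    have "v z * cmod (h (\<phi> z) * deriv g z)
        \<le> v z * (cmod (h' (\<phi> z) * deriv \<phi> z * g z + h (\<phi> z) * deriv g z)
              + cmod (h' (\<phi> z) * deriv \<phi> z * g z))"
      using norm_triangle_ineq4[of "h' (\<phi> z) * deriv \<phi> z * g z + h (\<phi> z) * deriv g z"
          "h' (\<phi> z) * deriv \<phi> z * g z"] v
      by (intro mult_left_mono) auto
    with 1 2 ha(1) show ?thesis by (simp add: distrib_left norm_mult mult.assoc)
  qed
  show thesis
    using M1 M2 unfolding v_def x_def by (rule that)
qed

lemma bounded_VC_operator_iff:
  assumes \<alpha>: "0 < \<alpha>" and \<phi>: "analytic_self_map \<phi>" and g: "g holomorphic_on unit_disk"
  shows "bounded_zygmund_operator \<alpha> \<beta> (VC_operator g \<phi>) \<longleftrightarrow>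
    (\<exists>M. \<forall>z\<in>unit_disk. (1 - (cmod z)\<^sup>2) powr \<beta> * (1 / (1 - (cmod (\<phi> z))\<^sup>2) powr \<alpha>) *
        cmod (g z * deriv \<phi> z) \<le> M) \<and>
    (\<exists>M. \<forall>z\<in>unit_disk. (1 - (cmod z)\<^sup>2) powr \<beta> * derivative_growth \<alpha> (cmod (\<phi> z)) *
        cmod (deriv g z) \<le> M)"
proof
  assume "bounded_zygmund_operator \<alpha> \<beta> (VC_operator g \<phi>)"
  from bounded_VC_operatorD[OF \<alpha> \<phi> g this] show
    "(\<exists>M. \<forall>z\<in>unit_disk. (1 - (cmod z)\<^sup>2) powr \<beta> * (1 / (1 - (cmod (\<phi> z))\<^sup>2) powr \<alpha>) *
        cmod (g z * deriv \<phi> z) \<le> M) \<and>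
    (\<exists>M. \<forall>z\<in>unit_disk. (1 - (cmod z)\<^sup>2) powr \<beta> * derivative_growth \<alpha> (cmod (\<phi> z)) *
        cmod (deriv g z) \<le> M)"
    by metis
next
  assume "(\<exists>M. \<forall>z\<in>unit_disk. (1 - (cmod z)\<^sup>2) powr \<beta> * (1 / (1 - (cmod (\<phi> z))\<^sup>2) powr \<alpha>) *
        cmod (g z * deriv \<phi> z) \<le> M) \<and>
    (\<exists>M. \<forall>z\<in>unit_disk. (1 - (cmod z)\<^sup>2) powr \<beta> * derivative_growth \<alpha> (cmod (\<phi> z)) *
        cmod (deriv g z) \<le> M)"
  then show "bounded_zygmund_operator \<alpha> \<beta> (VC_operator g \<phi>)"
    using bounded_VC_operatorI[OF \<alpha> \<phi> g] by blast
qed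

section \<open>The criteria with powers of the self-map\<close>

lemma comparable_finite_powr_iff:
  assumes \<gamma>: "0 < \<gamma>" and \<phi>: "analytic_self_map \<phi>"
  shows "comparable_finite (1 / (exp 1 * (2 * \<gamma>) powr \<gamma>)) (2 * 2 powr \<gamma>)
      (SUP n::nat. ennreal ((real n + 1) powr \<gamma>) * weighted_norm \<beta> (\<lambda>z. u z * \<phi> z ^ n))
      (SUP z\<in>unit_disk. ennreal ((1 - (cmod z)\<^sup>2) powr \<beta> / (1 - (cmod (\<phi> z))\<^sup>2) powr \<gamma> * cmod (u z)))
    \<longleftrightarrow> (\<exists>M. \<forall>z\<in>unit_disk.
          (1 - (cmod z)\<^sup>2) powr \<beta> * (1 / (1 - (cmod (\<phi> z))\<^sup>2) powr \<gamma>) * cmod (u z) \<le> M)"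
  using comparable_finite_power_weights_iff[of \<phi> "\<lambda>n. (real n + 1) powr \<gamma>" "exp 1 * (2 * \<gamma>) powr \<gamma>"
      "2 * 2 powr \<gamma>" "\<lambda>r. 1 / (1 - r\<^sup>2) powr \<gamma>" \<beta> u]
    Suc_powr_mult_power_le[OF \<gamma>] exists_Suc_powr_mult_power_ge[OF \<gamma>] \<phi> \<gamma>
  by (simp add: analytic_self_map_def)

lemma comparable_finite_ln_iff:
  assumes \<phi>: "analytic_self_map \<phi>"
  shows "comparable_finite (1 / (1 + 2 * exp 1 / ln 2)) 6
      (SUP n::nat. ennreal (ln (real n + 2)) * weighted_norm \<beta> (\<lambda>z. u z * \<phi> z ^ n))
      (SUP z\<in>unit_disk. ennreal ((1 - (cmod z)\<^sup>2) powr \<beta> * ln (2 / (1 - (cmod (\<phi> z))\<^sup>2)) * cmod (u z)))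
    \<longleftrightarrow> (\<exists>M. \<forall>z\<in>unit_disk.
          (1 - (cmod z)\<^sup>2) powr \<beta> * ln (2 / (1 - (cmod (\<phi> z))\<^sup>2)) * cmod (u z) \<le> M)"
proof (rule comparable_finite_power_weights_iff)
  show "0 < 1 + 2 * exp 1 / ln (2::real)" by (intro add_pos_pos divide_pos_pos) auto
  show "\<phi> ` unit_disk \<subseteq> unit_disk" using \<phi> by (simp add: analytic_self_map_def)
qed (use ln_mult_power_le exists_ln_mult_power_ge in auto)





theorem theorem2p1:
  fixes \<alpha> \<beta> :: real
  assumes "0 < \<beta>"
  shows
    "(0 < \<alpha> \<and> \<alpha> < 1 \<longrightarrow>
       (\<exists>C1>0. \<exists>C2>0. \<forall>\<phi> g. analytic_self_map \<phi> \<and> g holomorphic_on unit_disk \<longrightarrow>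
         (bounded_zygmund_operator \<alpha> \<beta> (VC_operator g \<phi>) \<longleftrightarrow>
            deriv g \<in> weighted_Hinf \<beta> \<and>
            comparable_finite C1 C2
              (SUP n::nat. ennreal ((real n + 1) powr \<alpha>) *
                 weighted_norm \<beta> (\<lambda>z. g z * deriv \<phi> z * \<phi> z ^ n))
              (SUP z\<in>unit_disk. ennreal ((1 - (cmod z)\<^sup>2) powr \<beta> / (1 - (cmod (\<phi> z))\<^sup>2) powr \<alpha> *
                 cmod (g z * deriv \<phi> z))))))
     \<and>
     (\<alpha> = 1 \<longrightarrow>
       (\<exists>C1>0. \<exists>C2>0. \<exists>C3>0. \<exists>C4>0. \<forall>\<phi> g. analytic_self_map \<phi> \<and> g holomorphic_on unit_disk \<longrightarrow>
         (bounded_zygmund_operator \<alpha> \<beta> (VC_operator g \<phi>) \<longleftrightarrow>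
            comparable_finite C1 C2
              (SUP n::nat. ennreal (real n + 1) *
                 weighted_norm \<beta> (\<lambda>z. g z * deriv \<phi> z * \<phi> z ^ n))
              (SUP z\<in>unit_disk. ennreal ((1 - (cmod z)\<^sup>2) powr \<beta> / (1 - (cmod (\<phi> z))\<^sup>2) *
                 cmod (g z * deriv \<phi> z))) \<and>
            comparable_finite C3 C4
              (SUP n::nat. ennreal (ln (real n + 2)) *
                 weighted_norm \<beta> (\<lambda>z. deriv g z * \<phi> z ^ n))
              (SUP z\<in>unit_disk. ennreal ((1 - (cmod z)\<^sup>2) powr \<beta> *
                 ln (2 / (1 - (cmod (\<phi> z))\<^sup>2)) * cmod (deriv g z))))))
     \<and>
     (1 < \<alpha> \<longrightarrow>
       (\<exists>C1>0. \<exists>C2>0. \<exists>C3>0. \<exists>C4>0. \<forall>\<phi> g. analytic_self_map \<phi> \<and> g holomorphic_on unit_disk \<longrightarrow>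
         (bounded_zygmund_operator \<alpha> \<beta> (VC_operator g \<phi>) \<longleftrightarrow>
            comparable_finite C1 C2
              (SUP n::nat. ennreal ((real n + 1) powr \<alpha>) *
                 weighted_norm \<beta> (\<lambda>z. g z * deriv \<phi> z * \<phi> z ^ n))
              (SUP z\<in>unit_disk. ennreal ((1 - (cmod z)\<^sup>2) powr \<beta> / (1 - (cmod (\<phi> z))\<^sup>2) powr \<alpha> *
                 cmod (g z * deriv \<phi> z))) \<and>
            comparable_finite C3 C4
              (SUP n::nat. ennreal ((real n + 1) powr (\<alpha> - 1)) *
                 weighted_norm \<beta> (\<lambda>z. deriv g z * \<phi> z ^ n))
              (SUP z\<in>unit_disk. ennreal ((1 - (cmod z)\<^sup>2) powr \<beta> / (1 - (cmod (\<phi> z))\<^sup>2) powr (\<alpha> - 1) *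
                 cmod (deriv g z))))))"
proof (intro conjI impI, goal_cases)
  let ?C = "\<lambda>\<gamma>::real. 1 / (exp 1 * (2 * \<gamma>) powr \<gamma>)" and ?D = "\<lambda>\<gamma>::real. 2 * 2 powr \<gamma>"
  have C: "0 < ?C \<gamma>" if "0 < \<gamma>" for \<gamma> using that by simp
  have D: "0 < ?D \<gamma>" for \<gamma> by simp
  have E: "0 < 1 / (1 + 2 * exp 1 / ln (2::real))" by (intro divide_pos_pos add_pos_pos) auto
  have six: "0 < (6::real)" by simp
  {
    case 1
    then have \<alpha>: "0 < \<alpha>" "\<alpha> < 1" by auto
    have growth: "derivative_growth \<alpha> r = 1" for r
      using \<alpha> by (simp add: derivative_growth_def)
    have Hinf: "deriv g \<in> weighted_Hinf \<beta> \<longleftrightarrow>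
        (\<exists>M. \<forall>z\<in>unit_disk. (1 - (cmod z)\<^sup>2) powr \<beta> * 1 * cmod (deriv g z) \<le> M)"
      if "g holomorphic_on unit_disk" for g
      using holomorphic_deriv[OF that open_ball]
      by (simp add: weighted_Hinf_def weighted_norm_def std_weight_def SUP_ennreal_less_top_iff[simplified])
    show ?case
      by (rule exI[of _ "?C \<alpha>"], rule conjI[OF C[OF \<alpha>(1)]], rule exI[of _ "?D \<alpha>"], rule conjI[OF D],
          intro allI impI, elim conjE)
        (simp only: bounded_VC_operator_iff[OF \<alpha>(1)] growth Hinf comparable_finite_powr_iff[OF \<alpha>(1)] conj_commute)
  next
    case 2
    \<comment> \<open>For \<open>\<alpha> = 1\<close> the powers of exponent one are written without \<open>powr\<close>.\<close>
    have den: "(SUP z\<in>unit_disk. ennreal ((1 - (cmod z)\<^sup>2) powr \<beta> / (1 - (cmod (\<phi> z))\<^sup>2) * cmod (u z)))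
        = (SUP z\<in>unit_disk. ennreal ((1 - (cmod z)\<^sup>2) powr \<beta> / (1 - (cmod (\<phi> z))\<^sup>2) powr 1 * cmod (u z)))"
      if "analytic_self_map \<phi>" for \<phi> u
    proof (intro SUP_cong refl)
      fix z :: complex assume "z \<in> unit_disk"
      then have "0 < 1 - (cmod (\<phi> z))\<^sup>2"
        using that disk_weight_pos[of "\<phi> z"] unfolding analytic_self_map_def by blast
      then show "ennreal ((1 - (cmod z)\<^sup>2) powr \<beta> / (1 - (cmod (\<phi> z))\<^sup>2) * cmod (u z))
          = ennreal ((1 - (cmod z)\<^sup>2) powr \<beta> / (1 - (cmod (\<phi> z))\<^sup>2) powr 1 * cmod (u z))" by simp
    qed
    have num: "(SUP n::nat. ennreal (real n + 1) * weighted_norm \<beta> (\<lambda>z. u z * \<phi> z ^ n))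
        = (SUP n::nat. ennreal ((real n + 1) powr 1) * weighted_norm \<beta> (\<lambda>z. u z * \<phi> z ^ n))" for u \<phi>
      by simp
    have growth: "derivative_growth 1 r = ln (2 / (1 - r\<^sup>2))" for r
      by (simp add: derivative_growth_def)
    show ?case
      unfolding 2
      by (rule exI[of _ "?C 1"], rule conjI[OF C[OF zero_less_one]], rule exI[of _ "?D 1"], rule conjI[OF D],
          rule exI, rule conjI[OF E], rule exI, rule conjI[OF six], intro allI impI, elim conjE)
        (simp only: num den bounded_VC_operator_iff[OF zero_less_one] comparable_finite_powr_iff[OF zero_less_one]
          comparable_finite_ln_iff growth)
  next
    case 3
    then have \<alpha>: "0 < \<alpha>" "0 < \<alpha> - 1" by auto
    have growth: "derivative_growth \<alpha> r = 1 / (1 - r\<^sup>2) powr (\<alpha> - 1)" for r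
      using \<alpha> by (simp add: derivative_growth_def)
    show ?case
      by (rule exI[of _ "?C \<alpha>"], rule conjI[OF C[OF \<alpha>(1)]], rule exI[of _ "?D \<alpha>"], rule conjI[OF D],
          rule exI[of _ "?C (\<alpha> - 1)"], rule conjI[OF C[OF \<alpha>(2)]], rule exI[of _ "?D (\<alpha> - 1)"], rule conjI[OF D],
          intro allI impI, elim conjE)
        (simp only: bounded_VC_operator_iff[OF \<alpha>(1)] comparable_finite_powr_iff[OF \<alpha>(1)]
          comparable_finite_powr_iff[OF \<alpha>(2)] growth)
  }
qed

end
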